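(* Let $\mathcal{A}$ be an $\omega$-homogeneous first-order structure. Suppose that all finitely generated substructures of $\mathcal{A}$ are finite and that $\mathrm{Age}(\mathcal{A})$ satisfies the Ramsey property. Suppose that $\mathcal{K}$ is a Fraïssé order class that is an order forgetful expansion of $\mathrm{Age}(\mathcal{A})$. Then for every dense subgroup $G$ of $\mathrm{Aut}(\mathcal{A})$, the space $\mathrm{NO}_{\mathcal{K}}(\mathcal{A})$ of normal orderings of $\mathcal{A}$ induced by $\mathcal{K}$, with its natural $G$-action, is the universal minimal flow of $G$.
   Context: Flows. A $G$-flow is a compact Hausdorff space $X$ with a continuous action $G\times X\to X$ of the topological group $G$. It is minimal if it has no proper non-empty closed $G$-invariant subset. A homomorphism of $G$-flows is a continuous $G$-equivariant map. The universal minimal flow $M(G)$ is the (unique up to isomorphism) minimal $G$-flow such that every minimal $G$-flow is the image of $M(G)$ under a surjective homomorphism. Structures. $\mathrm{Aut}(\mathcal{A})$ carries the topology of pointwise convergence on the (discrete) universe of $\mathcal{A}$; dense subgroups carry the subspace topology. $\mathcal{A}$ is $\omega$-homogeneous if every partial isomorphism between two finite subsets of $\mathcal{A}$ (i.e. a bijection extending to an isomorphism of the generated substructures) extends to an automorphism of $\mathcal{A}$. $\mathrm{Age}(\mathcal{A})$ is the class of (structures isomorphic to) finitely generated substructures of $\mathcal{A}$. A class of finitely generated structures in a fixed language (closed under isomorphism) is a Fraïssé class if it has: the hereditary property (closed under finitely generated substructures); the joint embedding property (any two members embed in a common member); the amalgamation property (for embeddings $i:A\to B$, $j:A\to C$ in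 the class there are $D$ in the class and embeddings $k:B\to D$, $l:C\to D$ with $k\circ i=l\circ j$). A class $\mathcal{F}$ of finite structures has the Ramsey property if for all $A\le B$ in $\mathcal{F}$ and every natural number $k\ge 2$ there is $C\in\mathcal{F}$ such that for every colouring with $k$ colours of the copies of $A$ in $C$ (substructures of $C$ isomorphic to $A$) there is a copy $B'$ of $B$ in $C$ such that all copies of $A$ in $B'$ have the same colour. Order expansions. Let $L$ be the language of $\mathcal{A}$ and $L'=L\cup\{<\}$ with $<$ a new binary relation symbol. A Fraïssé order class is a Fraïssé class $\mathcal{K}$ of finite $L'$-structures in which $<$ is interpreted as a linear ordering. It is an expansion of $\mathrm{Age}(\mathcal{A})$ if $\mathrm{Age}(\mathcal{A})=\{K|L:K\in\mathcal{K}\}$ (the class of $L$-reducts). It is order forgetful if $(A,<),(B,\prec)\in\mathcal{K}$ and $A\cong B$ imply $(A,<)\cong(B,\prec)$. $\mathrm{NO}_{\mathcal{K}}(\mathcal{A})$ is the set of linear orderings $\prec$ of the universe of $\mathcal{A}$ such that $(A,\prec|A)\in\mathcal{K}$ for every finitely generated substructure $A$ of $\mathcal{A}$, with the subspace topology from $2^{\mathcal{A}\times\mathcal{A}}$ (product topology). $G\le\mathrm{Aut}(\mathcal{A})$ acts on it by $a\,(g\prec)\,b\iff g^{-1}a\prec g^{-1}b$. *)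

theory Defs
  imports "HOL-Analysis.Analysis" "HOL-Algebra.Group_Action"
begin

section \<open>First-order structures\<close>

text \<open>The symbols of a language form sets, so that a language may lack function or relation symbols.
  Constants are function symbols of arity 0.\<close>

record ('f, 'r) language =
  funs :: "'f set"
  rels :: "'r set"
  farity :: "'f \<Rightarrow> nat"
  rarity :: "'r \<Rightarrow> nat"

text \<open>The values of the interpretations on symbols outside the language, or on tuples of the wrong
  length or not inside the universe, are irrelevant: no notion below except equality of records
  depends on them.\<close>

record ('f, 'r, 'a) struct =
  univ :: "'a set"
  fint :: "'f \<Rightarrow> 'a list \<Rightarrow> 'a"
  rint :: "'r \<Rightarrow> 'a list \<Rightarrow> bool"

definition closed_under :: "('f, 'r) language \<Rightarrow> ('f, 'r, 'a) struct \<Rightarrow> 'a set \<Rightarrow> bool" where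
  "closed_under L A S \<longleftrightarrow> S \<subseteq> univ A \<and>
     (\<forall>f\<in>funs L. \<forall>xs. length xs = farity L f \<and> set xs \<subseteq> S \<longrightarrow> fint A f xs \<in> S)"

text \<open>Structures are nonempty, as usual in first-order logic.\<close>

definition is_structure :: "('f, 'r) language \<Rightarrow> ('f, 'r, 'a) struct \<Rightarrow> bool" where
  "is_structure L A \<longleftrightarrow> univ A \<noteq> {} \<and> closed_under L A (univ A)"

definition embedding ::
  "('f, 'r) language \<Rightarrow> ('a \<Rightarrow> 'b) \<Rightarrow> ('f, 'r, 'a) struct \<Rightarrow> ('f, 'r, 'b) struct \<Rightarrow> bool" where
  "embedding L h A B \<longleftrightarrow> inj_on h (univ A) \<and> h ` univ A \<subseteq> univ B \<and>
     (\<forall>f\<in>funs L. \<forall>xs. length xs = farity L f \<and> set xs \<subseteq> univ A \<longrightarrow>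
        h (fint A f xs) = fint B f (map h xs)) \<and>
     (\<forall>r\<in>rels L. \<forall>xs. length xs = rarity L r \<and> set xs \<subseteq> univ A \<longrightarrow>
        (rint A r xs \<longleftrightarrow> rint B r (map h xs)))"

definition isomorphism ::
  "('f, 'r) language \<Rightarrow> ('a \<Rightarrow> 'b) \<Rightarrow> ('f, 'r, 'a) struct \<Rightarrow> ('f, 'r, 'b) struct \<Rightarrow> bool" where
  "isomorphism L h A B \<longleftrightarrow> embedding L h A B \<and> h ` univ A = univ B"

definition embeds ::
  "('f, 'r) language \<Rightarrow> ('f, 'r, 'a) struct \<Rightarrow> ('f, 'r, 'b) struct \<Rightarrow> bool" where
  "embeds L A B \<longleftrightarrow> (\<exists>h. embedding L h A B)"

definition isomorphic ::
  "('f, 'r) language \<Rightarrow> ('f, 'r, 'a) struct \<Rightarrow> ('f, 'r, 'b) struct \<Rightarrow> bool" where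
  "isomorphic L A B \<longleftrightarrow> (\<exists>h. isomorphism L h A B)"

text \<open>A substructure is determined by its universe; the interpretations are inherited.\<close>

definition induced :: "('f, 'r, 'a) struct \<Rightarrow> 'a set \<Rightarrow> ('f, 'r, 'a) struct" where
  "induced A S = A\<lparr>univ := S\<rparr>"

definition substructures :: "('f, 'r) language \<Rightarrow> ('f, 'r, 'a) struct \<Rightarrow> 'a set set" where
  "substructures L A = {S. S \<subseteq> univ A \<and> is_structure L (induced A S)}"

definition generated ::
  "('f, 'r) language \<Rightarrow> ('f, 'r, 'a) struct \<Rightarrow> 'a set \<Rightarrow> 'a set" where
  "generated L A X = \<Inter>{S. closed_under L A S \<and> X \<subseteq> S}"

definition fg_substructures :: "('f, 'r) language \<Rightarrow> ('f, 'r, 'a) struct \<Rightarrow> 'a set set" where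
  "fg_substructures L A =
     {S \<in> substructures L A. \<exists>X. finite X \<and> X \<subseteq> univ A \<and> S = generated L A X}"

definition fg_structure :: "('f, 'r) language \<Rightarrow> ('f, 'r, 'a) struct \<Rightarrow> bool" where
  "fg_structure L A \<longleftrightarrow> is_structure L A \<and> univ A \<in> fg_substructures L A"

definition partial_isomorphism ::
  "('f, 'r) language \<Rightarrow> ('f, 'r, 'a) struct \<Rightarrow> ('a \<Rightarrow> 'a) \<Rightarrow> 'a set \<Rightarrow> 'a set \<Rightarrow> bool" where
  "partial_isomorphism L A p S T \<longleftrightarrow> bij_betw p S T \<and>
     (\<exists>h. isomorphism L h (induced A (generated L A S)) (induced A (generated L A T)) \<and>
          (\<forall>x\<in>S. h x = p x))"

definition omega_homogeneous :: "('f, 'r) language \<Rightarrow> ('f, 'r, 'a) struct \<Rightarrow> bool" where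
  "omega_homogeneous L A \<longleftrightarrow>
     (\<forall>S T p. finite S \<and> S \<subseteq> univ A \<and> finite T \<and> T \<subseteq> univ A \<and> partial_isomorphism L A p S T \<longrightarrow>
        (\<exists>g. isomorphism L g A A \<and> (\<forall>x\<in>S. g x = p x)))"


section \<open>Classes of structures\<close>

text \<open>A class of structures is represented by the set of its members whose universe is a subset of a
  fixed type \<open>'b\<close>. For classes of finite structures closed under isomorphism, \<open>'b = nat\<close> loses
  nothing.\<close>

definition age ::
  "('f, 'r) language \<Rightarrow> ('f, 'r, 'a) struct \<Rightarrow> ('f, 'r, 'b) struct set" where
  "age L A = {B. is_structure L B \<and> (\<exists>S\<in>fg_substructures L A. isomorphic L B (induced A S))}"

definition fraisse_class :: "('f, 'r) language \<Rightarrow> ('f, 'r, 'b) struct set \<Rightarrow> bool" where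
  "fraisse_class L F \<longleftrightarrow>
     (\<forall>A\<in>F. fg_structure L A) \<and>
     \<comment> \<open>closure under isomorphism\<close>
     (\<forall>A\<in>F. \<forall>B. is_structure L B \<and> isomorphic L A B \<longrightarrow> B \<in> F) \<and>
     \<comment> \<open>hereditary property\<close>
     (\<forall>A\<in>F. \<forall>S\<in>fg_substructures L A. induced A S \<in> F) \<and>
     \<comment> \<open>joint embedding property\<close>
     (\<forall>A\<in>F. \<forall>B\<in>F. \<exists>C\<in>F. embeds L A C \<and> embeds L B C) \<and>
     \<comment> \<open>amalgamation property\<close>
     (\<forall>A\<in>F. \<forall>B\<in>F. \<forall>C\<in>F. \<forall>i j. embedding L i A B \<and> embedding L j A C \<longrightarrow>
        (\<exists>D\<in>F. \<exists>k l. embedding L k B D \<and> embedding L l C D \<and>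
           (\<forall>x\<in>univ A. k (i x) = l (j x))))"

definition copies ::
  "('f, 'r) language \<Rightarrow> ('f, 'r, 'a) struct \<Rightarrow> ('f, 'r, 'b) struct \<Rightarrow> 'b set set" where
  "copies L A C = {S \<in> substructures L C. isomorphic L A (induced C S)}"

definition ramsey_property :: "('f, 'r) language \<Rightarrow> ('f, 'r, 'b) struct set \<Rightarrow> bool" where
  "ramsey_property L F \<longleftrightarrow>
     (\<forall>A\<in>F. \<forall>B\<in>F. embeds L A B \<longrightarrow>
        (\<forall>k\<ge>2. \<exists>C\<in>F. \<forall>c. c \<in> copies L A C \<rightarrow> {..<k::nat} \<longrightarrow>
           (\<exists>B'\<in>copies L B C. \<exists>i. \<forall>A'\<in>copies L A (induced C B'). c A' = i)))"


section \<open>Order expansions\<close>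

text \<open>The new symbol \<open><\<close> is the relation symbol \<open>None\<close>; the symbols \<open>r\<close> of \<open>L\<close> become \<open>Some r\<close>.\<close>

definition order_language :: "('f, 'r) language \<Rightarrow> ('f, 'r option) language" where
  "order_language L = \<lparr>funs = funs L, rels = insert None (Some ` rels L), farity = farity L,
     rarity = (\<lambda>s. case s of None \<Rightarrow> 2 | Some r \<Rightarrow> rarity L r)\<rparr>"

definition reduct :: "('f, 'r option, 'a) struct \<Rightarrow> ('f, 'r, 'a) struct" where
  "reduct B = \<lparr>univ = univ B, fint = fint B, rint = (\<lambda>r. rint B (Some r))\<rparr>"

definition expand :: "('f, 'r, 'a) struct \<Rightarrow> ('a \<times> 'a \<Rightarrow> bool) \<Rightarrow> ('f, 'r option, 'a) struct" where
  "expand A R = \<lparr>univ = univ A, fint = fint A,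
     rint = (\<lambda>s xs. case s of None \<Rightarrow> R (xs ! 0, xs ! 1) | Some r \<Rightarrow> rint A r xs)\<rparr>"

definition linear_ordering :: "'a set \<Rightarrow> ('a \<times> 'a \<Rightarrow> bool) \<Rightarrow> bool" where
  "linear_ordering S R \<longleftrightarrow> strict_linear_order_on S {p \<in> S \<times> S. R p}"

definition fraisse_order_class ::
  "('f, 'r) language \<Rightarrow> ('f, 'r option, 'b) struct set \<Rightarrow> bool" where
  "fraisse_order_class L K \<longleftrightarrow> fraisse_class (order_language L) K \<and>
     (\<forall>B\<in>K. finite (univ B) \<and> linear_ordering (univ B) (\<lambda>(x, y). rint B None [x, y]))"

text \<open>Equality of records is harmless here: both sides contain all representatives, whatever their
  irrelevant values, because \<open>age L A\<close> and a Fraisse class \<open>K\<close> are closed under isomorphism.\<close>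

definition expansion_of_age ::
  "('f, 'r) language \<Rightarrow> ('f, 'r, 'a) struct \<Rightarrow> ('f, 'r option, 'b) struct set \<Rightarrow> bool" where
  "expansion_of_age L A K \<longleftrightarrow> age L A = reduct ` K"

definition order_forgetful ::
  "('f, 'r) language \<Rightarrow> ('f, 'r option, 'b) struct set \<Rightarrow> bool" where
  "order_forgetful L K \<longleftrightarrow>
     (\<forall>B\<in>K. \<forall>C\<in>K. isomorphic L (reduct B) (reduct C) \<longrightarrow> isomorphic (order_language L) B C)"

text \<open>A structure with universe in another type belongs to a class \<open>K\<close> (closed under isomorphism)
  iff it is isomorphic to one of the representatives in \<open>K\<close>.

  Elements of the power of 2 with exponent \<open>univ A \<times> univ A\<close> are extensional functions, as in
  \<^term>\<open>topspace (product_topology X I)\<close>.\<close>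

definition normal_orderings ::
  "('f, 'r) language \<Rightarrow> ('f, 'r, 'a) struct \<Rightarrow> ('f, 'r option, 'b) struct set
     \<Rightarrow> ('a \<times> 'a \<Rightarrow> bool) set" where
  "normal_orderings L A K =
     {R \<in> extensional (univ A \<times> univ A). linear_ordering (univ A) R \<and>
        (\<forall>S\<in>fg_substructures L A.
           \<exists>C\<in>K. isomorphic (order_language L) (expand (induced A S) R) C)}"

definition normal_orderings_topology ::
  "('f, 'r) language \<Rightarrow> ('f, 'r, 'a) struct \<Rightarrow> ('f, 'r option, 'b) struct set
     \<Rightarrow> ('a \<times> 'a \<Rightarrow> bool) topology" where
  "normal_orderings_topology L A K =
     subtopology (product_topology (\<lambda>_. discrete_topology UNIV) (univ A \<times> univ A))
       (normal_orderings L A K)"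

definition normal_orderings_action ::
  "('f, 'r) language \<Rightarrow> ('f, 'r, 'a) struct \<Rightarrow> ('f, 'r option, 'b) struct set
     \<Rightarrow> ('a \<Rightarrow> 'a) \<Rightarrow> ('a \<times> 'a \<Rightarrow> bool) \<Rightarrow> ('a \<times> 'a \<Rightarrow> bool)" where
  "normal_orderings_action L A K g =
     (\<lambda>R \<in> normal_orderings L A K. \<lambda>p \<in> univ A \<times> univ A.
        R (inv_into (univ A) g (fst p), inv_into (univ A) g (snd p)))"


section \<open>Automorphism groups\<close>

definition aut_group :: "('f, 'r) language \<Rightarrow> ('f, 'r, 'a) struct \<Rightarrow> ('a \<Rightarrow> 'a) monoid" where
  "aut_group L A = (BijGroup (univ A))\<lparr>carrier := {g \<in> Bij (univ A). isomorphism L g A A}\<rparr>"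

definition aut_topology :: "('f, 'r) language \<Rightarrow> ('f, 'r, 'a) struct \<Rightarrow> ('a \<Rightarrow> 'a) topology" where
  "aut_topology L A =
     subtopology (product_topology (\<lambda>_. discrete_topology (univ A)) (univ A))
       (carrier (aut_group L A))"


section \<open>Flows\<close>

definition topological_group :: "('g, 'm) monoid_scheme \<Rightarrow> 'g topology \<Rightarrow> bool" where
  "topological_group G T \<longleftrightarrow> group G \<and> topspace T = carrier G \<and>
     continuous_map (prod_topology T T) T (\<lambda>(g, h). g \<otimes>\<^bsub>G\<^esub> h) \<and>
     continuous_map T T (\<lambda>g. inv\<^bsub>G\<^esub> g)"

definition flow ::
  "('g, 'm) monoid_scheme \<Rightarrow> 'g topology \<Rightarrow> 'x topology \<Rightarrow> ('g \<Rightarrow> 'x \<Rightarrow> 'x) \<Rightarrow> bool" where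
  "flow G T X \<phi> \<longleftrightarrow> topological_group G T \<and> compact_space X \<and> Hausdorff_space X \<and>
     group_action G (topspace X) \<phi> \<and>
     continuous_map (prod_topology T X) X (\<lambda>(g, x). \<phi> g x)"

text \<open>Minimal flows are nonempty; otherwise no minimal flow could map onto all of them.\<close>

definition minimal_flow ::
  "('g, 'm) monoid_scheme \<Rightarrow> 'g topology \<Rightarrow> 'x topology \<Rightarrow> ('g \<Rightarrow> 'x \<Rightarrow> 'x) \<Rightarrow> bool" where
  "minimal_flow G T X \<phi> \<longleftrightarrow> flow G T X \<phi> \<and> topspace X \<noteq> {} \<and>
     (\<forall>C. closedin X C \<and> C \<noteq> {} \<and> (\<forall>g\<in>carrier G. \<phi> g ` C \<subseteq> C) \<longrightarrow> C = topspace X)"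

definition flow_homomorphism ::
  "('g, 'm) monoid_scheme \<Rightarrow> 'x topology \<Rightarrow> ('g \<Rightarrow> 'x \<Rightarrow> 'x) \<Rightarrow> 'y topology \<Rightarrow> ('g \<Rightarrow> 'y \<Rightarrow> 'y)
     \<Rightarrow> ('x \<Rightarrow> 'y) \<Rightarrow> bool" where
  "flow_homomorphism G X \<phi> Y \<psi> h \<longleftrightarrow> continuous_map X Y h \<and>
     (\<forall>g\<in>carrier G. \<forall>x\<in>topspace X. h (\<phi> g x) = \<psi> g (h x))"

text \<open>HOL cannot quantify over types inside a formula, so the type \<open>'y\<close> of the points of the
  minimal flows to be covered is a parameter. A theorem concluding
  \<open>universal_minimal_flow TYPE('y) G T X \<phi>\<close> for a type variable \<open>'y\<close> not occurring in its
  hypotheses asserts the universal property for all minimal flows.\<close>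

definition universal_minimal_flow ::
  "'y itself \<Rightarrow> ('g, 'm) monoid_scheme \<Rightarrow> 'g topology \<Rightarrow> 'x topology \<Rightarrow> ('g \<Rightarrow> 'x \<Rightarrow> 'x) \<Rightarrow> bool"
where
  "universal_minimal_flow (_ :: 'y itself) G T X \<phi> \<longleftrightarrow> minimal_flow G T X \<phi> \<and>
     (\<forall>(Y :: 'y topology) \<psi>. minimal_flow G T Y \<psi> \<longrightarrow>
        (\<exists>h. flow_homomorphism G X \<phi> Y \<psi> h \<and> h ` topspace X = topspace Y))"

end

theory Submission
  imports Defs
begin

text \<open>
  Write \<open>NO\<close> for the space of normal orderings and fix \<open>R \<in> NO\<close>. Since \<open>K\<close> is order forgetful,
  isomorphic finite substructures \<open>S\<close>, \<open>S'\<close> carry isomorphic restrictions of any two normal orderings;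
  as isomorphisms between finite substructures are induced by elements of \<open>G\<close> (homogeneity and density),
  every \<open>G\<close>-orbit in \<open>NO\<close> is dense, so \<open>NO\<close> is minimal.

  Let \<open>Y\<close> be a minimal flow. The Ramsey property and compactness of \<open>Y\<close> give a point \<open>y\<^sub>0\<close> of \<open>Y\<close> such
  that \<open>g y\<^sub>0\<close> and \<open>h y\<^sub>0\<close> are close whenever \<open>g R\<close> and \<open>h R\<close> agree on a large finite substructure.
  Hence \<open>g R \<mapsto> g y\<^sub>0\<close> extends to a continuous equivariant map from \<open>NO\<close> to \<open>Y\<close>, which is onto by
  minimality of \<open>Y\<close>. Closeness is expressed by pairs of open sets with disjoint closures, so that no
  uniform structure on \<open>Y\<close> and no extension of the flow to the closure of \<open>G\<close> is needed.
\<close>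

section \<open>Embeddings and isomorphisms\<close>

text \<open>Two opposite demands explain the pairs of open sets with disjoint closures. The
  conditions imposed on \<open>y\<^sub>0\<close> must be closed, so that compactness of
  \<open>Y\<close> reduces them to finitely many; forbidding \<open>g y\<^sub>0\<close> in
  \<open>P\<close> together with \<open>h y\<^sub>0\<close> in \<open>Q\<close> is a closed
  condition if \<open>P\<close> and \<open>Q\<close> are open. But a finite \<open>S\<close> such
  that no element fixing \<open>S\<close> pointwise moves a point of \<open>P\<close> into
  \<open>Q\<close> comes from projecting along the compact \<open>Y\<close>, which needs closed
  sets. Normality of \<open>Y\<close> supplies pairs serving both ends around any two distinct
  points. The Ramsey property colours copies of \<open>S\<close>, whereas the position of
  \<open>g y\<close> is governed by an embedding of \<open>S\<close>. Finite linear orders are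
  rigid, so prescribing the order of \<open>S\<close> leaves at most one embedding onto each copy
  ordered by \<open>R\<close>. Finitely many conditions then hold at a translate of an arbitrary
  point \<open>y\<close>, by the inverse of an element that carries a finite substructure, order
  included, onto a monochromatic copy.\<close>

lemma univ_induced [simp]: "univ (induced A S) = S"
  and fint_induced [simp]: "fint (induced A S) = fint A"
  and rint_induced [simp]: "rint (induced A S) = rint A"
  by (simp_all add: induced_def)

lemma induced_induced [simp]: "induced (induced A S) T = induced A T"
  by (simp add: induced_def)

section \<open>Substructures and generation\<close>

lemma substructures_iff:
  "S \<in> substructures L A \<longleftrightarrow> S \<noteq> {} \<and> closed_under L A S"
  by (auto simp: substructures_def is_structure_def closed_under_def)

lemma generated_closed:
  assumes "closed_under L A S"
  shows "generated L A S = S"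
  using assms by (auto simp: generated_def)

lemma fg_substructures_finite:
  assumes "S \<in> substructures L A" "finite S"
  shows "S \<in> fg_substructures L A"
proof -
  have "closed_under L A S"
    using assms by (simp add: substructures_iff)
  then have "S \<subseteq> univ A" "S = generated L A S"
    by (simp_all add: closed_under_def generated_closed)
  then show ?thesis
    using assms by (auto simp: fg_substructures_def)
qed

lemma generated_closed_under:
  assumes "is_structure L A" "X \<subseteq> univ A"
  shows "closed_under L A (generated L A X)"
proof -
  have U: "closed_under L A (univ A)"
    using assms by (simp add: is_structure_def)
  have "generated L A X \<subseteq> univ A"
    using U assms by (auto simp: generated_def)
  moreover have "fint A f xs \<in> generated L A X"
    if f: "f \<in> funs L" and l: "length xs = farity L f" and xs: "set xs \<subseteq> generated L A X" for f xs
  proof -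
    have "fint A f xs \<in> S" if "closed_under L A S" "X \<subseteq> S" for S
    proof -
      have "set xs \<subseteq> S"
        using xs that by (auto simp: generated_def)
      then show ?thesis
        using that f l by (auto simp: closed_under_def)
    qed
    then show ?thesis
      by (auto simp: generated_def)
  qed
  ultimately show ?thesis
    by (simp add: closed_under_def)
qed

lemma subset_generated: "X \<subseteq> generated L A X"
  by (auto simp: generated_def)

section \<open>Calculus of embeddings and isomorphisms\<close>

lemma embedding_comp:
  assumes h: "embedding L h A B" and k: "embedding L k B C"
  shows "embedding L (k \<circ> h) A C"
  unfolding embedding_def
proof (intro conjI ballI allI impI)
  have sub: "h ` univ A \<subseteq> univ B" and inj: "inj_on h (univ A)"
    using h by (auto simp: embedding_def)
  show "inj_on (k \<circ> h) (univ A)"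
    using h k sub by (intro comp_inj_on) (auto simp: embedding_def intro: inj_on_subset)
  show "(k \<circ> h) ` univ A \<subseteq> univ C"
    using h k by (auto simp: embedding_def)
  fix f xs assume "f \<in> funs L" "length xs = farity L f \<and> set xs \<subseteq> univ A"
  moreover from this have "set (map h xs) \<subseteq> univ B"
    using sub by auto
  ultimately show "(k \<circ> h) (fint A f xs) = fint C f (map (k \<circ> h) xs)"
    using h k by (simp add: embedding_def)
next
  fix r xs assume "r \<in> rels L" "length xs = rarity L r \<and> set xs \<subseteq> univ A"
  moreover from this have "set (map h xs) \<subseteq> univ B"
    using h by (auto simp: embedding_def)
  ultimately show "rint A r xs \<longleftrightarrow> rint C r (map (k \<circ> h) xs)"
    using h k by (simp add: embedding_def)
qed

lemma isomorphism_comp: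
  assumes "isomorphism L h A B" "isomorphism L k B C"
  shows "isomorphism L (k \<circ> h) A C"
proof -
  have "embedding L (k \<circ> h) A C"
    using assms embedding_comp[of L h A B k C] by (simp add: isomorphism_def)
  then show ?thesis
    using assms unfolding isomorphism_def by (metis image_comp)
qed

lemma isomorphism_bij_betw:
  "isomorphism L h A B \<Longrightarrow> bij_betw h (univ A) (univ B)"
  by (simp add: isomorphism_def embedding_def bij_betw_def)

text \<open>Closure of \<open>A\<close> under its functions matters: \<open>inv_into\<close>
  recovers \<open>fint A f xs\<close> from its image only if this value lies in the
  universe.\<close>

lemma isomorphism_inv:
  assumes h: "isomorphism L h A B" and A: "is_structure L A"
  shows "isomorphism L (inv_into (univ A) h) B A"
proof -
  let ?k = "inv_into (univ A) h"
  have inj: "inj_on h (univ A)" and im: "h ` univ A = univ B"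
    using h by (auto simp: isomorphism_def embedding_def)
  have bij: "bij_betw ?k (univ B) (univ A)"
    using inj im by (metis bij_betw_def bij_betw_inv_into)
  have hk: "map h (map ?k ys) = ys" and kU: "set (map ?k ys) \<subseteq> univ A"
    if "set ys \<subseteq> univ B" for ys
    using that im by (auto intro!: map_idI simp: f_inv_into_f inv_into_into subset_iff)
  have "?k (fint B f ys) = fint A f (map ?k ys)"
    if "f \<in> funs L" "length ys = farity L f" "set ys \<subseteq> univ B" for f ys
  proof -
    let ?xs = "map ?k ys"
    have "fint A f ?xs \<in> univ A"
      using A that kU by (simp add: is_structure_def closed_under_def)
    moreover have "h (fint A f ?xs) = fint B f ys"
    proof -
      have "h (fint A f ?xs) = fint B f (map h ?xs)"
        using h that kU[OF that(3)] unfolding isomorphism_def embedding_def by simp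
      then show ?thesis
        by (simp only: hk[OF that(3)])
    qed
    ultimately show ?thesis
      using inj by (metis inv_into_f_f)
  qed
  moreover have "rint B r ys \<longleftrightarrow> rint A r (map ?k ys)"
    if "r \<in> rels L" "length ys = rarity L r" "set ys \<subseteq> univ B" for r ys
  proof -
    have "rint A r (map ?k ys) = rint B r (map h (map ?k ys))"
      using h that kU[OF that(3)] unfolding isomorphism_def embedding_def by simp
    then show ?thesis
      by (simp only: hk[OF that(3)])
  qed
  moreover have "inj_on ?k (univ B)" "?k ` univ B = univ A"
    using bij by (auto simp: bij_betw_def)
  ultimately show ?thesis
    unfolding isomorphism_def embedding_def by blast
qed

lemma isomorphism_is_structure:
  assumes h: "isomorphism L h A B" and A: "is_structure L A"
  shows "is_structure L B"
proof -
  have im: "h ` univ A = univ B"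
    using h by (simp add: isomorphism_def)
  have "fint B f ys \<in> univ B"
    if f: "f \<in> funs L" "length ys = farity L f" and ys: "set ys \<subseteq> univ B" for f ys
  proof -
    have "ys \<in> lists (h ` univ A)"
      using ys im by auto
    then obtain xs where xs: "ys = map h xs" "set xs \<subseteq> univ A"
      by (auto simp: lists_image)
    then have "fint B f ys = h (fint A f xs)"
      using h f by (simp add: isomorphism_def embedding_def)
    moreover have "fint A f xs \<in> univ A"
      using A f xs by (simp add: is_structure_def closed_under_def)
    ultimately show ?thesis
      using im by auto
  qed
  then show ?thesis
    using A im by (auto simp: is_structure_def closed_under_def)
qed

text \<open>Allows passing to the extensional version of an isomorphism, as group elements require;
  values of functions stay in the universe, where the two maps agree.\<close>

lemma isomorphism_cong:
  assumes h: "isomorphism L h A B" and A: "is_structure L A"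
    and eq: "\<And>x. x \<in> univ A \<Longrightarrow> k x = h x"
  shows "isomorphism L k A B"
  unfolding isomorphism_def embedding_def
proof (intro conjI ballI allI impI)
  have map: "map k xs = map h xs" if "set xs \<subseteq> univ A" for xs
    using that eq by auto
  have im: "k ` univ A = h ` univ A"
    using eq by auto
  show "inj_on k (univ A)"
    using h eq by (simp add: isomorphism_def embedding_def cong: inj_on_cong)
  show "k ` univ A = univ B" "k ` univ A \<subseteq> univ B"
    using h im by (simp_all add: isomorphism_def)
  fix f xs assume f: "f \<in> funs L" "length xs = farity L f \<and> set xs \<subseteq> univ A"
  then have "fint A f xs \<in> univ A"
    using A by (simp add: is_structure_def closed_under_def)
  then have "k (fint A f xs) = fint B f (map h xs)"
    using h f eq by (simp add: isomorphism_def embedding_def)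
  then show "k (fint A f xs) = fint B f (map k xs)"
    using map f by metis
next
  fix r xs assume r: "r \<in> rels L" "length xs = rarity L r \<and> set xs \<subseteq> univ A"
  then have "rint A r xs \<longleftrightarrow> rint B r (map h xs)"
    using h by (simp add: isomorphism_def embedding_def)
  moreover have "map k xs = map h xs"
    using r eq by auto
  ultimately show "rint A r xs \<longleftrightarrow> rint B r (map k xs)"
    by metis
qed

lemma embedding_imp_isomorphism:
  assumes "embedding L h A B"
  shows "isomorphism L h A (induced B (h ` univ A))"
  using assms by (simp add: isomorphism_def embedding_def)

lemma isomorphism_induced:
  assumes "isomorphism L h A B" "S \<subseteq> univ A"
  shows "isomorphism L h (induced A S) (induced B (h ` S))"
proof -
  have "embedding L id (induced A S) A"
    using assms by (auto simp: embedding_def)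
  moreover have "embedding L h A B"
    using assms by (simp add: isomorphism_def)
  ultimately have "embedding L (h \<circ> id) (induced A S) B"
    by (rule embedding_comp)
  from embedding_imp_isomorphism[OF this] show ?thesis
    by simp
qed

lemma isomorphism_id: "isomorphism L id A A"
  by (simp add: isomorphism_def embedding_def)

lemma isomorphicI: "isomorphism L h A B \<Longrightarrow> isomorphic L A B"
  unfolding isomorphic_def by (rule exI[of _ h])

lemma isomorphic_refl: "isomorphic L A A"
  unfolding isomorphic_def by (rule exI) (rule isomorphism_id)

lemma isomorphic_sym: "isomorphic L A B \<Longrightarrow> is_structure L A \<Longrightarrow> isomorphic L B A"
  by (metis isomorphic_def isomorphism_inv)

lemma isomorphic_trans: "isomorphic L A B \<Longrightarrow> isomorphic L B C \<Longrightarrow> isomorphic L A C"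
  by (metis isomorphic_def isomorphism_comp)

lemma isomorphic_is_structure: "isomorphic L A B \<Longrightarrow> is_structure L A \<Longrightarrow> is_structure L B"
  by (metis isomorphic_def isomorphism_is_structure)

lemma isomorphism_finite: "isomorphism L h A B \<Longrightarrow> finite (univ A) \<longleftrightarrow> finite (univ B)"
  by (metis bij_betw_finite isomorphism_bij_betw)

text \<open>Members of \<open>K\<close> and of the age are represented on sets of natural numbers;
  this gives every finite substructure such a representative.\<close>

lemma finite_structure_nat:
  fixes A :: "('f, 'r, 'a) struct"
  assumes "is_structure L A" "finite (univ A)"
  obtains B :: "('f, 'r, nat) struct" where "is_structure L B" "isomorphic L A B"
proof -
  obtain h :: "'a \<Rightarrow> nat" where h: "inj_on h (univ A)"
    using assms finite_imp_inj_to_nat_seg by blast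
  let ?k = "inv_into (univ A) h"
  let ?B = "\<lparr>univ = h ` univ A, fint = \<lambda>f xs. h (fint A f (map ?k xs)),
    rint = \<lambda>r xs. rint A r (map ?k xs)\<rparr>"
  have mk: "map ?k (map h xs) = xs" if "set xs \<subseteq> univ A" for xs
    using that h by (auto intro!: map_idI simp: subset_iff)
  have "isomorphism L h A ?B"
    using h by (simp add: isomorphism_def embedding_def mk del: map_map)
  then have "isomorphic L A ?B"
    by (rule isomorphicI)
  moreover from this have "is_structure L ?B"
    using assms by (rule_tac isomorphic_is_structure)
  ultimately show thesis
    by (rule_tac that)
qed

section \<open>Order expansions\<close>

lemma univ_expand [simp]: "univ (expand A R) = univ A"
  and reduct_expand [simp]: "reduct (expand A R) = A"
  and rint_expand_None [simp]: "rint (expand A R) None [a, b] \<longleftrightarrow> R (a, b)"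
  by (simp_all add: expand_def reduct_def)

lemma univ_reduct [simp]: "univ (reduct B) = univ B"
  by (simp add: reduct_def)

lemma induced_expand: "induced (expand A R) S = expand (induced A S) R"
  by (simp add: expand_def induced_def fun_eq_iff split: option.split)

lemma is_structure_order_language [simp]:
  "is_structure (order_language L) B \<longleftrightarrow> is_structure L (reduct B)"
  by (simp add: is_structure_def closed_under_def order_language_def reduct_def)

lemma isomorphism_order_language:
  "isomorphism (order_language L) h B C \<longleftrightarrow> isomorphism L h (reduct B) (reduct C) \<and>
     (\<forall>a\<in>univ B. \<forall>b\<in>univ B. rint B None [a, b] \<longleftrightarrow> rint C None [h a, h b])"
proof -
  have "(\<forall>xs. length xs = 2 \<and> set xs \<subseteq> univ B \<longrightarrow> rint B None xs = rint C None (map h xs)) \<longleftrightarrow>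
     (\<forall>a\<in>univ B. \<forall>b\<in>univ B. rint B None [a, b] \<longleftrightarrow> rint C None [h a, h b])"
    by (auto simp: length_Suc_conv numeral_2_eq_2)
  then show ?thesis
    by (auto simp: isomorphism_def embedding_def order_language_def reduct_def)
qed

lemma isomorphism_expand:
  "isomorphism (order_language L) h (expand A R) (expand B R') \<longleftrightarrow> isomorphism L h A B \<and>
     (\<forall>a\<in>univ A. \<forall>b\<in>univ A. R (a, b) \<longleftrightarrow> R' (h a, h b))"
  by (simp add: isomorphism_order_language)

lemma isomorphic_reduct:
  "isomorphic (order_language L) B C \<Longrightarrow> isomorphic L (reduct B) (reduct C)"
  by (auto simp: isomorphic_def isomorphism_order_language)

lemma linear_ordering_iff:
  "linear_ordering S R \<longleftrightarrow> (\<forall>a\<in>S. \<not> R (a, a)) \<and>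
     (\<forall>a\<in>S. \<forall>b\<in>S. a \<noteq> b \<longrightarrow> R (a, b) \<or> R (b, a)) \<and>
     (\<forall>a\<in>S. \<forall>b\<in>S. \<forall>c\<in>S. R (a, b) \<longrightarrow> R (b, c) \<longrightarrow> R (a, c))"
proof -
  let ?r = "{p \<in> S \<times> S. R p}"
  have "irrefl ?r \<longleftrightarrow> (\<forall>a\<in>S. \<not> R (a, a))"
    by (auto simp: irrefl_def)
  moreover have "total_on S ?r \<longleftrightarrow> (\<forall>a\<in>S. \<forall>b\<in>S. a \<noteq> b \<longrightarrow> R (a, b) \<or> R (b, a))"
    by (auto simp: total_on_def)
  moreover have "trans ?r \<longleftrightarrow>
      (\<forall>a\<in>S. \<forall>b\<in>S. \<forall>c\<in>S. R (a, b) \<longrightarrow> R (b, c) \<longrightarrow> R (a, c))"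
    unfolding trans_def by simp blast
  ultimately show ?thesis
    unfolding linear_ordering_def strict_linear_order_on_def by argo
qed

lemma linear_ordering_pullback:
  assumes "linear_ordering T R'" "inj_on h S" "h ` S \<subseteq> T"
    and R: "\<And>a b. a \<in> S \<Longrightarrow> b \<in> S \<Longrightarrow> R (a, b) \<longleftrightarrow> R' (h a, h b)"
  shows "linear_ordering S R"
proof -
  have h: "h a \<in> T" if "a \<in> S" for a
    using that assms by auto
  have "h a \<noteq> h b" if "a \<in> S" "b \<in> S" "a \<noteq> b" for a b
    using that assms by (auto dest: inj_onD)
  with h have total: "R' (h a, h b) \<or> R' (h b, h a)" if "a \<in> S" "b \<in> S" "a \<noteq> b" for a b
    using assms(1) that unfolding linear_ordering_iff by simp
  have irrefl: "\<not> R' (h a, h a)" if "a \<in> S" for a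
    using assms(1) h that unfolding linear_ordering_iff by simp
  have trans: "R' (h a, h c)"
    if "a \<in> S" "b \<in> S" "c \<in> S" "R' (h a, h b)" "R' (h b, h c)" for a b c
    using assms(1) h[OF that(1)] h[OF that(2)] h[OF that(3)] that(4,5)
    unfolding linear_ordering_iff by blast
  show ?thesis
    unfolding linear_ordering_iff
  proof (intro conjI ballI impI)
    show "\<not> R (a, a)" if "a \<in> S" for a
      using irrefl R that by simp
    show "R (a, b) \<or> R (b, a)" if "a \<in> S" "b \<in> S" "a \<noteq> b" for a b
      using total R that by simp
    show "R (a, c)" if "a \<in> S" "b \<in> S" "c \<in> S" "R (a, b)" "R (b, c)" for a b c
      using trans[OF that(1-3)] R that by simp
  qed
qed

lemma linear_ordering_isomorphism:
  assumes "isomorphism (order_language L) h B C"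
    and "linear_ordering (univ C) (\<lambda>(x, y). rint C None [x, y])"
  shows "linear_ordering (univ B) (\<lambda>(x, y). rint B None [x, y])"
proof -
  have h: "inj_on h (univ B)" "h ` univ B \<subseteq> univ C"
    using assms(1) by (simp_all add: isomorphism_def embedding_def)
  have "rint B None [a, b] \<longleftrightarrow> rint C None [h a, h b]" if "a \<in> univ B" "b \<in> univ B" for a b
    using assms(1) that by (simp add: isomorphism_order_language)
  then show ?thesis
    using linear_ordering_pullback[OF assms(2) h, of "\<lambda>(x, y). rint B None [x, y]"] by simp
qed

text \<open>Both \<open>e a\<close> and \<open>e' a\<close> have as many predecessors in
  \<open>T\<close> as \<open>a\<close> has in \<open>S\<close>, and in a finite linear order the
  number of predecessors determines the element.\<close>

lemma linear_ordering_rigid: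
  assumes fin: "finite S" and R: "linear_ordering S R" and T: "linear_ordering T R'"
    and e: "bij_betw e S T" "\<And>a b. a \<in> S \<Longrightarrow> b \<in> S \<Longrightarrow> R (a, b) \<longleftrightarrow> R' (e a, e b)"
    and e': "bij_betw e' S T" "\<And>a b. a \<in> S \<Longrightarrow> b \<in> S \<Longrightarrow> R (a, b) \<longleftrightarrow> R' (e' a, e' b)"
    and a: "a \<in> S"
  shows "e a = e' a"
proof -
  define D where "D x = {y \<in> S. R (y, x)}" for x
  define D' where "D' x = {y \<in> T. R' (y, x)}" for x
  have finT: "finite T"
    using fin e(1) bij_betw_finite by blast
  have D: "card (D' (f x)) = card (D x)" if "x \<in> S" "bij_betw f S T"
    "\<And>a b. a \<in> S \<Longrightarrow> b \<in> S \<Longrightarrow> R (a, b) \<longleftrightarrow> R' (f a, f b)" for x f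
  proof -
    have "f ` D x = D' (f x)"
      using that by (auto simp: D_def D'_def bij_betw_def image_iff)
    moreover have "inj_on f (D x)"
      using that by (auto simp: D_def bij_betw_def inj_on_def)
    ultimately show ?thesis
      by (metis card_image)
  qed
  have less: "card (D' x) < card (D' y)" if "x \<in> T" "y \<in> T" "R' (x, y)" for x y
  proof (rule psubset_card_mono)
    show "finite (D' y)"
      using finT by (simp add: D'_def)
    show "D' x \<subset> D' y"
    proof
      have "R' (z, y)" if "z \<in> T" "R' (z, x)" for z
        using T that \<open>x \<in> T\<close> \<open>y \<in> T\<close> \<open>R' (x, y)\<close> unfolding linear_ordering_iff by metis
      then show "D' x \<subseteq> D' y"
        by (auto simp: D'_def)
      have "x \<in> D' y" "x \<notin> D' x"
        using T that by (auto simp: D'_def linear_ordering_iff)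
      then show "D' x \<noteq> D' y"
        by blast
    qed
  qed
  have "e a \<in> T" "e' a \<in> T" "card (D' (e a)) = card (D' (e' a))"
    using a e e' D[OF a e] D[OF a e'] by (auto simp: bij_betw_def)
  then have "\<not> R' (e a, e' a)" "\<not> R' (e' a, e a)"
    using less[of "e a" "e' a"] less[of "e' a" "e a"] by auto
  then show ?thesis
    using T \<open>e a \<in> T\<close> \<open>e' a \<in> T\<close> unfolding linear_ordering_iff by metis
qed

section \<open>Normal orderings\<close>

text \<open>The values of \<open>f\<close> on \<open>F\<close> cut out a basic box around
  \<open>f\<close> on which \<open>P\<close> persists. The negation of \<open>P\<close> satisfies
  the same hypothesis, so such sets are closed as well.\<close>

lemma openin_product_discrete:
  assumes "finite F" "F \<subseteq> I"
    and P: "\<And>f g. f \<in> I \<rightarrow>\<^sub>E V \<Longrightarrow> g \<in> I \<rightarrow>\<^sub>E V \<Longrightarrow> (\<And>i. i \<in> F \<Longrightarrow> f i = g i) \<Longrightarrow> P f \<Longrightarrow> P g"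
  shows "openin (product_topology (\<lambda>_. discrete_topology V) I) {f \<in> I \<rightarrow>\<^sub>E V. P f}"
  unfolding openin_product_topology_alt
proof
  fix f assume "f \<in> {f \<in> I \<rightarrow>\<^sub>E V. P f}"
  then have f: "f \<in> I \<rightarrow>\<^sub>E V" "P f"
    by simp_all
  let ?W = "\<lambda>i. if i \<in> F then {f i} else V"
  have "finite {i \<in> I. ?W i \<noteq> topspace (discrete_topology V)}"
    by (rule finite_subset[OF _ assms(1)]) auto
  moreover have "\<forall>i\<in>I. openin (discrete_topology V) (?W i)"
    using f by auto
  moreover have "f \<in> Pi\<^sub>E I ?W"
    using f by (auto simp: PiE_iff)
  moreover have "Pi\<^sub>E I ?W \<subseteq> {f \<in> I \<rightarrow>\<^sub>E V. P f}"
  proof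
    fix g assume g: "g \<in> Pi\<^sub>E I ?W"
    have "g i \<in> ?W i" if "i \<in> I" for i
      using g that by (rule PiE_mem)
    then have V: "g i \<in> V" and F: "i \<in> F \<longrightarrow> g i = f i" if "i \<in> I" for i
      using that f(1) PiE_mem[OF f(1) that] by (metis singletonD)+
    have "g \<in> I \<rightarrow>\<^sub>E V"
      using V g by (auto simp: PiE_iff)
    moreover have "P g"
      using F assms(2) by (intro P[OF f(1) calculation _ f(2)]) auto
    ultimately show "g \<in> {f \<in> I \<rightarrow>\<^sub>E V. P f}"
      by simp
  qed
  ultimately show "\<exists>W. finite {i \<in> I. W i \<noteq> topspace (discrete_topology V)} \<and>
      (\<forall>i\<in>I. openin (discrete_topology V) (W i)) \<and> f \<in> Pi\<^sub>E I W \<and>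
      Pi\<^sub>E I W \<subseteq> {f \<in> I \<rightarrow>\<^sub>E V. P f}"
    by (intro exI[of _ ?W] conjI)
qed

lemma continuous_map_locally_constant:
  assumes "f \<in> topspace X \<rightarrow> V"
    and "\<And>x. x \<in> topspace X \<Longrightarrow> \<exists>W. openin X W \<and> x \<in> W \<and> (\<forall>y\<in>W. f y = f x)"
  shows "continuous_map X (discrete_topology V) f"
  unfolding continuous_map_def
proof (intro conjI allI impI)
  show "f \<in> topspace X \<rightarrow> topspace (discrete_topology V)"
    using assms(1) by simp
  fix B
  show "openin X {x \<in> topspace X. f x \<in> B}"
  proof (subst openin_subopen, rule ballI)
    fix x assume "x \<in> {x \<in> topspace X. f x \<in> B}"
    then have x: "x \<in> topspace X" "f x \<in> B"
      by simp_all
    then obtain W where "openin X W" "x \<in> W" "\<forall>y\<in>W. f y = f x"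
      using assms(2) by metis
    moreover from this x have "W \<subseteq> {x \<in> topspace X. f x \<in> B}"
      using openin_subset by fastforce
    ultimately show "\<exists>T. openin X T \<and> x \<in> T \<and> T \<subseteq> {x \<in> topspace X. f x \<in> B}"
      by metis
  qed
qed

section \<open>Finite substructures and their normal orders\<close>

locale order_expansion =
  fixes L :: "('f, 'r) language"
    and A :: "('f, 'r, 'a) struct"
    and K :: "('f, 'r option, nat) struct set"
  assumes A_structure: "is_structure L A"
    and locally_finite: "\<forall>S\<in>fg_substructures L A. finite S"
    and fraisse: "fraisse_order_class L K"
    and expansion: "expansion_of_age L A K"
    and forgetful: "order_forgetful L K"
begin

abbreviation "U \<equiv> univ A"
abbreviation "\<S> \<equiv> fg_substructures L A"
abbreviation "NO \<equiv> normal_orderings L A K"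
abbreviation "OL \<equiv> order_language L"

lemma fg_iff: "S \<in> \<S> \<longleftrightarrow> S \<subseteq> U \<and> finite S \<and> is_structure L (induced A S)"
proof -
  have "S \<in> \<S> \<longleftrightarrow> S \<in> substructures L A \<and> finite S"
    using locally_finite fg_substructures_finite unfolding fg_substructures_def by blast
  then show ?thesis
    unfolding substructures_def by blast
qed

lemma fg_subset: "S \<in> \<S> \<Longrightarrow> S \<subseteq> U"
  and fg_finite: "S \<in> \<S> \<Longrightarrow> finite S"
  and fg_structure: "S \<in> \<S> \<Longrightarrow> is_structure L (induced A S)"
  by (simp_all add: fg_iff)

lemma fg_generated: "S \<in> \<S> \<Longrightarrow> generated L A S = S"
  by (simp add: fg_substructures_def substructures_iff generated_closed)

lemma fg_cover:
  assumes "finite X" "X \<subseteq> U"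
  obtains S where "S \<in> \<S>" "X \<subseteq> S"
proof -
  obtain a where a: "a \<in> U"
    using A_structure by (auto simp: is_structure_def)
  \<comment> \<open>Structures are nonempty, but the empty set generates nothing if the language has
    no constants; the extra point \<open>a\<close> prevents this.\<close>
  let ?X = "insert a X"
  let ?S = "generated L A ?X"
  have S: "closed_under L A ?S"
    using generated_closed_under A_structure assms a by (metis insert_subset)
  moreover have sub: "?X \<subseteq> ?S"
    by (rule subset_generated)
  ultimately have "?S \<in> substructures L A"
    by (auto simp: substructures_iff)
  then have "?S \<in> \<S>"
    using assms a unfolding fg_substructures_def by blast
  then show thesis
    using that sub by blast
qed

lemma fg_image:
  assumes "S \<in> \<S>" "isomorphism L h (induced A S) B" "B = induced A T" "T \<subseteq> U"
  shows "T \<in> \<S>"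
  using assms fg_iff isomorphism_is_structure[of L h "induced A S" B]
    isomorphism_finite[of L h "induced A S" B] by simp

lemma fg_sub:
  assumes "S \<in> \<S>" "T \<subseteq> S" "is_structure L (induced A T)"
  shows "T \<in> \<S>"
  using assms finite_subset by (auto simp: fg_iff)

lemma K_linear: "C \<in> K \<Longrightarrow> linear_ordering (univ C) (\<lambda>(x, y). rint C None [x, y])"
  using fraisse by (simp add: fraisse_order_class_def)

lemma K_finite: "C \<in> K \<Longrightarrow> finite (univ C)"
  using fraisse by (simp add: fraisse_order_class_def)

lemma K_hereditary: "C \<in> K \<Longrightarrow> S \<in> fg_substructures OL C \<Longrightarrow> induced C S \<in> K"
  using fraisse by (simp add: fraisse_order_class_def fraisse_class_def)

text \<open>The axioms of linear orders involve at most three points. These lie in a common finite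
  substructure, on which membership in \<open>K\<close> forces linearity. Only conditions on finite
  sets remain, which is what makes \<open>NO\<close> closed.\<close>

lemma NO_iff:
  "R \<in> NO \<longleftrightarrow> R \<in> extensional (U \<times> U) \<and>
    (\<forall>S\<in>\<S>. \<exists>C\<in>K. isomorphic OL (expand (induced A S) R) C)"
proof -
  have "linear_ordering U R"
    if R: "\<forall>S\<in>\<S>. \<exists>C\<in>K. isomorphic OL (expand (induced A S) R) C"
  proof -
    have lin: "linear_ordering S R" if S: "S \<in> \<S>" for S
    proof -
      obtain C h where "C \<in> K" "isomorphism OL h (expand (induced A S) R) C"
        using R S by (auto simp: isomorphic_def)
      from linear_ordering_isomorphism[OF this(2) K_linear[OF this(1)]] show ?thesis
        by simp
    qed
    show ?thesis
      unfolding linear_ordering_iff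
    proof (intro conjI ballI impI)
      fix a assume "a \<in> U"
      then obtain S where S: "S \<in> \<S>" "{a} \<subseteq> S"
        using fg_cover[of "{a}"] by auto
      show "\<not> R (a, a)"
        using lin[OF S(1)] S(2) by (simp add: linear_ordering_iff)
    next
      fix a b assume "a \<in> U" "b \<in> U" and ne: "a \<noteq> b"
      then obtain S where S: "S \<in> \<S>" "{a, b} \<subseteq> S"
        using fg_cover[of "{a, b}"] by auto
      show "R (a, b) \<or> R (b, a)"
        using lin[OF S(1)] S(2) ne by (simp add: linear_ordering_iff)
    next
      fix a b c assume "a \<in> U" "b \<in> U" "c \<in> U" and r: "R (a, b)" "R (b, c)"
      then obtain S where S: "S \<in> \<S>" "{a, b, c} \<subseteq> S"
        using fg_cover[of "{a, b, c}"] by auto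
      then have "a \<in> S" "b \<in> S" "c \<in> S"
        by auto
      then show "R (a, c)"
        using lin[OF S(1)] r unfolding linear_ordering_iff by metis
    qed
  qed
  then show ?thesis
    unfolding normal_orderings_def by auto
qed

lemma NO_linear:
  assumes "R \<in> NO" "S \<subseteq> U"
  shows "linear_ordering S R"
proof -
  have "linear_ordering U R"
    using assms by (simp add: normal_orderings_def)
  from linear_ordering_pullback[OF this, of id S R] show ?thesis
    using assms by simp
qed

text \<open>This is where order forgetfulness enters, after both ordered structures have been moved
  to representatives in \<open>K\<close>. The map \<open>p\<close> may differ from any isomorphism
  given beforehand.\<close>

lemma NO_isomorphism:
  assumes R: "R \<in> NO" "R' \<in> NO" and S: "S \<in> \<S>" "S' \<in> \<S>"
    and iso: "isomorphic L (induced A S) (induced A S')"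
  obtains p where "isomorphism L p (induced A S) (induced A S')"
    "\<And>a b. a \<in> S \<Longrightarrow> b \<in> S \<Longrightarrow> R (a, b) \<longleftrightarrow> R' (p a, p b)"
proof -
  let ?B = "expand (induced A S) R" and ?B' = "expand (induced A S') R'"
  obtain C C' where C: "C \<in> K" "isomorphic OL ?B C" and C': "C' \<in> K" "isomorphic OL ?B' C'"
    using R S NO_iff by metis
  have str: "is_structure L (induced A S)" "is_structure L (induced A S')"
    using S fg_structure by blast+
  have "isomorphic L (reduct C) (induced A S)"
    using isomorphic_reduct[OF C(2)] str isomorphic_sym by simp
  moreover have "isomorphic L (induced A S') (reduct C')"
    using isomorphic_reduct[OF C'(2)] by simp
  ultimately have "isomorphic L (reduct C) (reduct C')"
    using iso isomorphic_trans by metis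
  then have "isomorphic OL C C'"
    using forgetful C(1) C'(1) by (simp add: order_forgetful_def)
  moreover have "isomorphic OL C' ?B'"
    by (rule isomorphic_sym[OF C'(2)]) (simp add: str)
  ultimately have "isomorphic OL ?B ?B'"
    using C(2) isomorphic_trans by metis
  then obtain p where "isomorphism OL p ?B ?B'"
    by (auto simp: isomorphic_def)
  then show thesis
    using that by (auto simp: isomorphism_expand)
qed

lemma normal_on_cong:
  assumes "\<And>a b. a \<in> S \<Longrightarrow> b \<in> S \<Longrightarrow> R (a, b) \<longleftrightarrow> R' (a, b)"
    and "isomorphic OL (expand (induced A S) R) C"
  shows "isomorphic OL (expand (induced A S) R') C"
proof -
  obtain h where "isomorphism OL h (expand (induced A S) R) C"
    using assms(2) by (auto simp: isomorphic_def)
  then have "isomorphism OL h (expand (induced A S) R') C"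
    using assms(1) by (simp add: isomorphism_order_language)
  then show ?thesis
    by (rule isomorphicI)
qed

text \<open>The hereditary property of \<open>K\<close>. It makes the family \<open>NS\<close>
  decrease along inclusions, as the compactness argument for \<open>NO_nonempty\<close>
  requires.\<close>

lemma normal_on_mono:
  assumes S: "S \<in> \<S>" "S \<subseteq> S'" and C: "C \<in> K" "isomorphic OL (expand (induced A S') R) C"
  shows "\<exists>D\<in>K. isomorphic OL (expand (induced A S) R) D"
proof -
  obtain h where h: "isomorphism OL h (expand (induced A S') R) C"
    using C(2) by (auto simp: isomorphic_def)
  have iso: "isomorphism OL h (expand (induced A S) R) (induced C (h ` S))"
    using isomorphism_induced[OF h, of S] S by (simp add: induced_expand)
  have sub: "h ` S \<subseteq> univ C"
    using h S by (auto simp: isomorphism_def)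
  have "is_structure OL (induced C (h ` S))"
    by (rule isomorphism_is_structure[OF iso]) (simp add: fg_structure S)
  with sub have "h ` S \<in> substructures OL C"
    by (simp add: substructures_def)
  then have "h ` S \<in> fg_substructures OL C"
    using fg_substructures_finite sub K_finite[OF C(1)] finite_subset by metis
  then have "induced C (h ` S) \<in> K"
    using K_hereditary C(1) by blast
  then show ?thesis
    using isomorphicI[OF iso] by blast
qed

text \<open>The order comes from a member of \<open>K\<close> whose reduct is isomorphic to
  \<open>induced A S\<close>. Outside \<open>S\<close> the relation is arbitrary and need not be an
  ordering.\<close>

lemma normal_on_exists:
  assumes S: "S \<in> \<S>"
  shows "\<exists>R\<in>extensional (U \<times> U). \<exists>C\<in>K. isomorphic OL (expand (induced A S) R) C"
proof -
  obtain B :: "('f, 'r, nat) struct" where B: "is_structure L B" "isomorphic L (induced A S) B"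
    using finite_structure_nat[of L "induced A S"] S fg_structure fg_finite by auto
  then have "isomorphic L B (induced A S)"
    using S fg_structure isomorphic_sym by blast
  then have "B \<in> age L A"
    using B S by (auto simp: age_def)
  then obtain C where C: "C \<in> K" "B = reduct C"
    using expansion by (auto simp: expansion_of_age_def)
  obtain h where h: "isomorphism L h (induced A S) (reduct C)"
    using B C by (auto simp: isomorphic_def)
  let ?R = "\<lambda>p\<in>U \<times> U. rint C None [h (fst p), h (snd p)]"
  have "a \<in> U" if "a \<in> S" for a
    using that S fg_subset by blast
  then have "isomorphism OL h (expand (induced A S) ?R) C"
    using h by (simp add: isomorphism_order_language)
  then have "isomorphic OL (expand (induced A S) ?R) C"
    by (rule isomorphicI)
  moreover have "?R \<in> extensional (U \<times> U)"
    by simp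
  ultimately show ?thesis
    using C(1) by blast
qed

section \<open>The compact space of normal orderings\<close>

abbreviation "TP \<equiv> product_topology (\<lambda>_. discrete_topology (UNIV :: bool set)) (U \<times> U)"
abbreviation "TN \<equiv> normal_orderings_topology L A K"

definition NS :: "'a set \<Rightarrow> ('a \<times> 'a \<Rightarrow> bool) set" where
  "NS S = {R \<in> U \<times> U \<rightarrow>\<^sub>E UNIV. \<exists>C\<in>K. isomorphic OL (expand (induced A S) R) C}"

lemma NO_eq: "NO = \<Inter> (NS ` \<S>)"
proof -
  have "\<S> \<noteq> {}"
    using fg_cover[of "{}"] by auto
  then show ?thesis
    by (auto simp: NS_def NO_iff PiE_def)
qed

text \<open>Membership in \<open>NS S\<close> depends only on the finitely many coordinates in
  \<open>S \<times> S\<close>, so the complement is open.\<close>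

lemma closedin_NS:
  assumes "S \<in> \<S>"
  shows "closedin TP (NS S)"
proof -
  have "openin TP {R \<in> U \<times> U \<rightarrow>\<^sub>E UNIV. \<not> (\<exists>C\<in>K. isomorphic OL (expand (induced A S) R) C)}"
  proof (rule openin_product_discrete)
    show "finite (S \<times> S)" "S \<times> S \<subseteq> U \<times> U"
      using assms fg_finite fg_subset by auto
    fix R R' assume "\<And>i. i \<in> S \<times> S \<Longrightarrow> R i = R' i"
      and n: "\<not> (\<exists>C\<in>K. isomorphic OL (expand (induced A S) R) C)"
    then have "R' (a, b) \<longleftrightarrow> R (a, b)" if "a \<in> S" "b \<in> S" for a b
      using that by auto
    then show "\<not> (\<exists>C\<in>K. isomorphic OL (expand (induced A S) R') C)"
      using n normal_on_cong[of S R' R] by blast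
  qed
  moreover have "{R \<in> U \<times> U \<rightarrow>\<^sub>E UNIV. \<not> (\<exists>C\<in>K. isomorphic OL (expand (induced A S) R) C)} =
      topspace TP - NS S"
    by (auto simp: NS_def)
  ultimately show ?thesis
    unfolding closedin_def by (auto simp: NS_def)
qed

lemma compact_space_TP: "compact_space TP"
  by (simp add: compact_space_product_topology compact_space_discrete_topology)

lemma closedin_NO: "closedin TP NO"
  unfolding NO_eq
proof (rule closedin_Inter)
  show "NS ` \<S> \<noteq> {}"
    using fg_cover[of "{}"] by auto
qed (use closedin_NS in auto)

lemma fg_directed:
  assumes "finite \<F>" "\<F> \<subseteq> \<S>"
  obtains S where "S \<in> \<S>" "\<And>T. T \<in> \<F> \<Longrightarrow> T \<subseteq> S"
proof -
  have "finite (\<Union>\<F>)" "\<Union>\<F> \<subseteq> U"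
    using assms fg_finite fg_subset by (auto simp: subset_iff)
  then obtain S where "S \<in> \<S>" "\<Union>\<F> \<subseteq> S"
    using fg_cover by metis
  then have "T \<subseteq> S" if "T \<in> \<F>" for T
    using that by blast
  with \<open>S \<in> \<S>\<close> show thesis
    by (rule that)
qed

text \<open>Finite intersection property in the compact power: finitely many substructures lie in a
  single \<open>S\<close>, and a relation normal on \<open>S\<close> is normal on each of
  them.\<close>

lemma NO_nonempty: "NO \<noteq> {}"
proof -
  have "\<Inter>\<G> \<noteq> {}" if \<G>: "finite \<G>" "\<G> \<subseteq> NS ` \<S>" for \<G>
  proof -
    obtain \<F> where \<F>: "finite \<F>" "\<F> \<subseteq> \<S>" "\<G> = NS ` \<F>"
      using \<G> finite_subset_image by metis
    obtain S where S: "S \<in> \<S>" "\<And>T. T \<in> \<F> \<Longrightarrow> T \<subseteq> S"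
      using fg_directed \<F> by metis
    obtain R C where R: "R \<in> extensional (U \<times> U)" "C \<in> K" "isomorphic OL (expand (induced A S) R) C"
      using normal_on_exists S(1) by blast
    have "R \<in> NS T" if "T \<in> \<F>" for T
      using normal_on_mono[OF _ S(2) R(2,3)] R(1) that \<F>(2) by (auto simp: NS_def PiE_def)
    then show ?thesis
      using \<F>(3) by blast
  qed
  moreover have "\<forall>C\<in>NS ` \<S>. closedin TP C"
    using closedin_NS by simp
  ultimately show ?thesis
    using compact_space_TP[unfolded compact_space_fip, rule_format, of "NS ` \<S>"] NO_eq by simp
qed

lemma topspace_TN [simp]: "topspace TN = NO"
  by (auto simp: normal_orderings_topology_def NO_iff PiE_def)

lemma compact_space_TN: "compact_space TN"
  using closedin_NO compact_space_TP
  by (simp add: normal_orderings_topology_def closedin_compact_space compact_space_subtopology)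

lemma Hausdorff_space_TN: "Hausdorff_space TN"
  by (simp add: normal_orderings_topology_def Hausdorff_space_subtopology
      Hausdorff_space_product_topology)

lemma openin_TN:
  assumes "finite F" "F \<subseteq> U \<times> U" "R \<in> NO"
  shows "openin TN {R' \<in> NO. \<forall>p\<in>F. R' p = R p}"
proof -
  have "openin TP {R' \<in> U \<times> U \<rightarrow>\<^sub>E UNIV. \<forall>p\<in>F. R' p = R p}"
    by (rule openin_product_discrete[OF assms(1,2)]) simp
  moreover have "{R' \<in> NO. \<forall>p\<in>F. R' p = R p} = NO \<inter> {R' \<in> U \<times> U \<rightarrow>\<^sub>E UNIV. \<forall>p\<in>F. R' p = R p}"
    by (auto simp: NO_iff PiE_def)
  ultimately show ?thesis
    unfolding normal_orderings_topology_def by (simp add: openin_subtopology_Int2)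
qed

lemma TN_basis:
  assumes "openin TN W" "R \<in> W"
  obtains S where "S \<in> \<S>" "\<And>R'. R' \<in> NO \<Longrightarrow> (\<And>a b. a \<in> S \<Longrightarrow> b \<in> S \<Longrightarrow> R' (a, b) = R (a, b)) \<Longrightarrow> R' \<in> W"
proof -
  obtain V where V: "openin TP V" "W = V \<inter> NO"
    using assms(1) unfolding normal_orderings_topology_def openin_subtopology by blast
  have "R \<in> V"
    using assms(2) V(2) by simp
  with V(1) obtain B where B:
    "finite {i \<in> U \<times> U. B i \<noteq> topspace (discrete_topology (UNIV :: bool set))}"
    "R \<in> Pi\<^sub>E (U \<times> U) B" "Pi\<^sub>E (U \<times> U) B \<subseteq> V"
    unfolding openin_product_topology_alt by auto
  let ?F = "{i \<in> U \<times> U. B i \<noteq> topspace (discrete_topology (UNIV :: bool set))}"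
  \<comment> \<open>Coordinates are pairs, so \<open>S\<close> has to contain both components of
    each of the finitely many restricted coordinates.\<close>
  have "finite (fst ` ?F \<union> snd ` ?F)" "fst ` ?F \<union> snd ` ?F \<subseteq> U"
    using B(1) by auto
  then obtain S where S: "S \<in> \<S>" "fst ` ?F \<union> snd ` ?F \<subseteq> S"
    by (rule fg_cover)
  have "R' \<in> W" if R': "R' \<in> NO" "\<And>a b. a \<in> S \<Longrightarrow> b \<in> S \<Longrightarrow> R' (a, b) = R (a, b)" for R'
  proof -
    have "R' i \<in> B i" if i: "i \<in> U \<times> U" for i
    proof (cases "B i = UNIV")
      case False
      then have "i \<in> ?F"
        using i by simp
      then have "fst i \<in> fst ` ?F" "snd i \<in> snd ` ?F"
        by (simp_all only: imageI)
      then have "fst i \<in> S" "snd i \<in> S"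
        by (simp_all only: subsetD[OF S(2) UnI1] subsetD[OF S(2) UnI2])
      then have "R' i = R i"
        using R'(2)[of "fst i" "snd i"] by simp
      with PiE_mem[OF B(2) i] show ?thesis
        by (simp only:)
    qed simp
    then have "R' \<in> Pi\<^sub>E (U \<times> U) B"
      using R'(1) by (auto simp: NO_iff PiE_def)
    then show ?thesis
      using B(3) V(2) R'(1) by blast
  qed
  with S(1) show thesis
    by (rule that)
qed

end

section \<open>The flow of normal orderings\<close>

locale dense_automorphism_group = order_expansion L A K
  for L :: "('f, 'r) language"
    and A :: "('f, 'r, 'a) struct"
    and K :: "('f, 'r option, nat) struct set" +
  fixes G :: "('a \<Rightarrow> 'a) set"
  assumes homogeneous: "omega_homogeneous L A"
    and subgroup_G: "subgroup G (aut_group L A)"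
    and dense_G: "aut_topology L A closure_of G = carrier (aut_group L A)"
begin

abbreviation "Aut \<equiv> carrier (aut_group L A)"
abbreviation "H \<equiv> (aut_group L A)\<lparr>carrier := G\<rparr>"
abbreviation "TG \<equiv> subtopology (aut_topology L A) G"
abbreviation "act \<equiv> normal_orderings_action L A K"

section \<open>The automorphism group and its subgroup \<open>G\<close>\<close>

lemma Aut_iff: "g \<in> Aut \<longleftrightarrow> g \<in> Bij U \<and> isomorphism L g A A"
  by (simp add: aut_group_def)

lemma aut_group_eq: "aut_group L A = (BijGroup U)\<lparr>carrier := Aut\<rparr>"
  by (simp add: aut_group_def)

lemma Aut_bij: "g \<in> Aut \<Longrightarrow> bij_betw g U U"
  and Aut_extensional: "g \<in> Aut \<Longrightarrow> g \<in> extensional U"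
  by (simp_all add: Aut_iff Bij_def)

lemma Aut_mem [simp]: "g \<in> Aut \<Longrightarrow> a \<in> U \<Longrightarrow> g a \<in> U"
  using Aut_bij bij_betwE by metis

lemma Aut_inv_mem [simp]: "g \<in> Aut \<Longrightarrow> a \<in> U \<Longrightarrow> inv_into U g a \<in> U"
  using Aut_iff Bij_inv_into_mem by metis

lemma Aut_inv_left [simp]: "g \<in> Aut \<Longrightarrow> a \<in> U \<Longrightarrow> inv_into U g (g a) = a"
  using Aut_bij bij_betw_inv_into_left by metis

lemma Aut_inv_right [simp]: "g \<in> Aut \<Longrightarrow> a \<in> U \<Longrightarrow> g (inv_into U g a) = a"
  using Aut_bij bij_betw_inv_into_right by metis

lemma Aut_inv_eq: "g \<in> Aut \<Longrightarrow> b \<in> U \<Longrightarrow> g b = a \<Longrightarrow> inv_into U g a = b"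
  using Aut_inv_left by metis

text \<open>Group elements are extensional on \<open>U\<close>. Composites and inverses therefore
  appear as \<open>compose U g h\<close> and \<open>restrict (inv_into U g) U\<close>, and this
  lemma recognises them as automorphisms.\<close>

lemma isomorphism_cong_Aut:
  assumes "isomorphism L g A A" "\<And>x. x \<in> U \<Longrightarrow> k x = g x" "k \<in> extensional U"
  shows "k \<in> Aut"
proof -
  have "isomorphism L k A A"
    by (rule isomorphism_cong[OF assms(1) A_structure assms(2)])
  then show ?thesis
    using isomorphism_bij_betw[of L k A A] assms(3) by (simp add: Aut_iff Bij_def)
qed

lemma Aut_compose: "g \<in> Aut \<Longrightarrow> h \<in> Aut \<Longrightarrow> compose U g h \<in> Aut"
  by (rule isomorphism_cong_Aut[of "g \<circ> h"])
    (simp_all add: Aut_iff isomorphism_comp[of L h A A g A] compose_def)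

lemma Aut_inv: "g \<in> Aut \<Longrightarrow> restrict (inv_into U g) U \<in> Aut"
  by (rule isomorphism_cong_Aut[of "inv_into U g"])
    (simp_all add: Aut_iff isomorphism_inv A_structure)

lemma Aut_id: "(\<lambda>x\<in>U. x) \<in> Aut"
  by (rule isomorphism_cong_Aut[OF isomorphism_id]) simp_all

lemma mult_BijGroup: "g \<in> Aut \<Longrightarrow> h \<in> Aut \<Longrightarrow> g \<otimes>\<^bsub>BijGroup U\<^esub> h = compose U g h"
  by (simp add: Aut_iff BijGroup_def)

lemma subgroup_Aut: "subgroup Aut (BijGroup U)"
proof (rule group.subgroupI[OF group_BijGroup])
  show "Aut \<subseteq> carrier (BijGroup U)"
    by (simp add: subset_iff Aut_iff BijGroup_def)
  show "Aut \<noteq> {}"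
    using Aut_id by auto
  show "inv\<^bsub>BijGroup U\<^esub> g \<in> Aut" if "g \<in> Aut" for g
    using that Aut_inv by (simp add: Aut_iff inv_BijGroup)
  show "g \<otimes>\<^bsub>BijGroup U\<^esub> h \<in> Aut" if "g \<in> Aut" "h \<in> Aut" for g h
    using that Aut_compose mult_BijGroup by simp
qed

lemma group_Aut: "group (aut_group L A)"
  using subgroup.subgroup_is_group[OF subgroup_Aut group_BijGroup] aut_group_eq by simp

lemma G_Aut: "g \<in> G \<Longrightarrow> g \<in> Aut"
  using subgroup.subset[OF subgroup_G] by blast

lemma group_H: "group H"
  by (rule subgroup.subgroup_is_group[OF subgroup_G group_Aut])

lemma mult_H: "g \<in> G \<Longrightarrow> h \<in> G \<Longrightarrow> g \<otimes>\<^bsub>aut_group L A\<^esub> h = compose U g h"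
  using mult_BijGroup G_Aut by (simp add: aut_group_def)

lemma one_H: "\<one>\<^bsub>H\<^esub> = (\<lambda>x\<in>U. x)"
  by (simp add: aut_group_def BijGroup_def)

lemma inv_H:
  assumes "g \<in> G"
  shows "inv\<^bsub>H\<^esub> g = restrict (inv_into U g) U"
proof -
  have "inv\<^bsub>H\<^esub> g = inv\<^bsub>aut_group L A\<^esub> g"
    using group.m_inv_consistent[OF group_Aut subgroup_G assms] .
  also have "\<dots> = inv\<^bsub>BijGroup U\<^esub> g"
    using group.m_inv_consistent[OF group_BijGroup subgroup_Aut G_Aut[OF assms]] aut_group_eq by simp
  also have "\<dots> = restrict (inv_into U g) U"
    using G_Aut[OF assms] by (simp add: Aut_iff inv_BijGroup)
  finally show ?thesis .
qed

lemma G_compose: "g \<in> G \<Longrightarrow> h \<in> G \<Longrightarrow> compose U g h \<in> G"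
  using mult_H monoid.m_closed[OF group.is_monoid[OF group_H], of g h] by simp

lemma G_inv: "g \<in> G \<Longrightarrow> restrict (inv_into U g) U \<in> G"
  using inv_H group.inv_closed[OF group_H, of g] by simp

lemma G_one: "(\<lambda>x\<in>U. x) \<in> G"
  using one_H monoid.one_closed[OF group.is_monoid[OF group_H]] by simp

lemma Aut_image:
  assumes "g \<in> Aut" "S \<in> \<S>"
  shows "isomorphism L g (induced A S) (induced A (g ` S))" "g ` S \<in> \<S>"
proof -
  show iso: "isomorphism L g (induced A S) (induced A (g ` S))"
    using assms fg_subset isomorphism_induced[of L g A A S] by (simp add: Aut_iff)
  have "g ` S \<subseteq> U"
    using fg_subset[OF assms(2)] assms(1) by auto
  with fg_image[OF assms(2) iso refl] show "g ` S \<in> \<S>"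
    by simp
qed

section \<open>The topology of pointwise convergence on \<open>G\<close>\<close>

abbreviation "TU \<equiv> product_topology (\<lambda>_. discrete_topology U) U"

lemma Aut_PiE: "g \<in> Aut \<Longrightarrow> g \<in> U \<rightarrow>\<^sub>E U"
  using Aut_extensional by (simp add: PiE_iff)

lemma TG_eq: "TG = subtopology TU G"
proof -
  have "Aut \<inter> G = G"
    using G_Aut by blast
  then show ?thesis
    by (simp add: aut_topology_def subtopology_subtopology)
qed

lemma topspace_TG [simp]: "topspace TG = G"
  unfolding TG_eq using Aut_PiE G_Aut by auto

lemma openin_TU: "finite F \<Longrightarrow> F \<subseteq> U \<Longrightarrow> openin TU {g \<in> U \<rightarrow>\<^sub>E U. \<forall>x\<in>F. g x = f x}"
  by (rule openin_product_discrete) (assumption, assumption, metis)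

lemma openin_TG:
  assumes "finite F" "F \<subseteq> U"
  shows "openin TG {g \<in> G. \<forall>x\<in>F. g x = f x}"
proof -
  have "{g \<in> G. \<forall>x\<in>F. g x = f x} = G \<inter> {g \<in> U \<rightarrow>\<^sub>E U. \<forall>x\<in>F. g x = f x}"
    using Aut_PiE G_Aut by blast
  then show ?thesis
    unfolding TG_eq using openin_TU[OF assms] by (simp add: openin_subtopology_Int2)
qed

lemma continuous_map_into_TG:
  assumes "f \<in> topspace X \<rightarrow> G"
    and "\<And>a. a \<in> U \<Longrightarrow> continuous_map X (discrete_topology U) (\<lambda>x. f x a)"
  shows "continuous_map X TG f"
proof -
  have "f x \<in> extensional U" if "x \<in> topspace X" for x
    using that assms(1) Aut_extensional G_Aut by (auto simp: Pi_iff)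
  then show ?thesis
    unfolding TG_eq continuous_map_in_subtopology continuous_map_componentwise
    using assms by (simp add: image_subset_iff)
qed

lemma TG_basis:
  assumes "openin TG W" "f \<in> W"
  obtains S where "S \<in> \<S>" "\<And>g. g \<in> G \<Longrightarrow> (\<And>x. x \<in> S \<Longrightarrow> g x = f x) \<Longrightarrow> g \<in> W"
proof -
  obtain V where V: "openin TU V" "W = V \<inter> G"
    using assms(1) unfolding TG_eq openin_subtopology by blast
  have "f \<in> V"
    using assms(2) V(2) by simp
  with V(1) obtain B where B: "finite {i \<in> U. B i \<noteq> topspace (discrete_topology U)}"
    "f \<in> Pi\<^sub>E U B" "Pi\<^sub>E U B \<subseteq> V"
    unfolding openin_product_topology_alt by auto
  let ?F = "{i \<in> U. B i \<noteq> topspace (discrete_topology U)}"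
  have "?F \<subseteq> U"
    by simp
  with B(1) obtain S where S: "S \<in> \<S>" "?F \<subseteq> S"
    by (rule fg_cover)
  have "g \<in> W" if g: "g \<in> G" "\<And>x. x \<in> S \<Longrightarrow> g x = f x" for g
  proof -
    have "g i \<in> B i" if i: "i \<in> U" for i
    proof (cases "B i = U")
      case True
      then show ?thesis
        using g(1) G_Aut i by simp
    next
      case False
      then have "i \<in> ?F"
        using i by simp
      then have "i \<in> S"
        using S(2) by (rule_tac subsetD)
      then show ?thesis
        using g(2) B(2) i by (metis PiE_mem)
    qed
    then have "g \<in> Pi\<^sub>E U B"
      using Aut_extensional[OF G_Aut[OF g(1)]] by (simp add: PiE_iff)
    then show ?thesis
      using B(3) V(2) g(1) by blast
  qed
  with S(1) show thesis
    by (rule that)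
qed

section \<open>Extending isomorphisms between finite substructures\<close>

lemma Aut_extend:
  assumes S: "S \<in> \<S>" "T \<in> \<S>" and p: "isomorphism L p (induced A S) (induced A T)"
  obtains g where "g \<in> Aut" "\<And>x. x \<in> S \<Longrightarrow> g x = p x"
proof -
  have "bij_betw p S T"
    using isomorphism_bij_betw[OF p] by simp
  then have "partial_isomorphism L A p S T"
    unfolding partial_isomorphism_def using p by (auto simp: fg_generated S)
  then obtain g where g: "isomorphism L g A A" "\<forall>x\<in>S. g x = p x"
    using homogeneous S fg_subset fg_finite unfolding omega_homogeneous_def by metis
  have "restrict g U \<in> Aut"
    by (rule isomorphism_cong_Aut[OF g(1)]) simp_all
  moreover have "restrict g U x = p x" if "x \<in> S" for x
    using that g(2) fg_subset[OF S(1)] by auto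
  ultimately show thesis
    by (rule that)
qed

text \<open>Homogeneity yields an automorphism extending \<open>p\<close>. The automorphisms
  agreeing with it on the finite set \<open>S\<close> form an open set, which meets the dense
  subgroup \<open>G\<close>.\<close>

lemma G_extend:
  assumes S: "S \<in> \<S>" "T \<in> \<S>" and p: "isomorphism L p (induced A S) (induced A T)"
  obtains g where "g \<in> G" "\<And>x. x \<in> S \<Longrightarrow> g x = p x"
proof -
  obtain f where f: "f \<in> Aut" "\<And>x. x \<in> S \<Longrightarrow> f x = p x"
    using Aut_extend[OF S p] by metis
  let ?W = "Aut \<inter> {g \<in> U \<rightarrow>\<^sub>E U. \<forall>x\<in>S. g x = f x}"
  have op: "openin (aut_topology L A) ?W"
    unfolding aut_topology_def using openin_TU[OF fg_finite fg_subset] S(1)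
    by (simp add: openin_subtopology_Int2)
  have mem: "f \<in> ?W"
    using f(1) Aut_PiE by simp
  have "f \<in> aut_topology L A closure_of G"
    using f(1) dense_G by simp
  then have "\<forall>W. f \<in> W \<and> openin (aut_topology L A) W \<longrightarrow> (\<exists>g. g \<in> G \<and> g \<in> W)"
    unfolding in_closure_of by (rule conjunct2)
  from this[rule_format, OF conjI[OF mem op]] obtain g where "g \<in> G" "g \<in> ?W"
    by (elim exE conjE)
  then have "g x = p x" if "x \<in> S" for x
    using that f(2) by simp
  with \<open>g \<in> G\<close> show thesis
    by (rule that)
qed

section \<open>Continuity of the group operations\<close>

lemma topological_group_H: "topological_group H TG"
  unfolding topological_group_def
proof (intro conjI)
  show "group H"
    by (rule group_H)
  show "topspace TG = carrier H"
    unfolding topspace_TG by simp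
  have "continuous_map (prod_topology TG TG) (discrete_topology U)
      (\<lambda>x. (case x of (g, h) \<Rightarrow> g \<otimes>\<^bsub>H\<^esub> h) a)"
    if a: "a \<in> U" for a
  proof (rule continuous_map_locally_constant)
    show "(\<lambda>x. (case x of (g, h) \<Rightarrow> g \<otimes>\<^bsub>H\<^esub> h) a) \<in> topspace (prod_topology TG TG) \<rightarrow> U"
      using a by (auto simp: mult_H compose_def G_Aut)
    fix x assume "x \<in> topspace (prod_topology TG TG)"
    then obtain g h where x: "x = (g, h)" "g \<in> G" "h \<in> G"
      by auto
    \<comment> \<open>The value of the product at \<open>a\<close> is determined by \<open>h\<close>
      at \<open>a\<close> and by \<open>g\<close> at \<open>h a\<close>.\<close>
    let ?W = "{g' \<in> G. \<forall>b\<in>{h a}. g' b = g b} \<times> {h' \<in> G. \<forall>b\<in>{a}. h' b = h b}"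
    have "openin (prod_topology TG TG) ?W"
      using a x G_Aut by (intro openin_prod_Times_iff[THEN iffD2] disjI2 conjI openin_TG) simp_all
    moreover have "x \<in> ?W"
      using x by simp
    moreover have "\<forall>y\<in>?W. (case y of (g, h) \<Rightarrow> g \<otimes>\<^bsub>H\<^esub> h) a = (case x of (g, h) \<Rightarrow> g \<otimes>\<^bsub>H\<^esub> h) a"
      using x a by (auto simp: mult_H compose_def)
    ultimately show "\<exists>W. openin (prod_topology TG TG) W \<and> x \<in> W \<and>
        (\<forall>y\<in>W. (case y of (g, h) \<Rightarrow> g \<otimes>\<^bsub>H\<^esub> h) a = (case x of (g, h) \<Rightarrow> g \<otimes>\<^bsub>H\<^esub> h) a)"
      by (intro exI[of _ ?W] conjI)
  qed
  moreover have "(\<lambda>(g, h). g \<otimes>\<^bsub>H\<^esub> h) ` topspace (prod_topology TG TG) \<subseteq> G"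
    using G_compose by (auto simp: mult_H)
  ultimately show "continuous_map (prod_topology TG TG) TG (\<lambda>(g, h). g \<otimes>\<^bsub>H\<^esub> h)"
    by (intro continuous_map_into_TG) (simp only: image_subset_iff_funcset)
  have "continuous_map TG (discrete_topology U) (\<lambda>g. (inv\<^bsub>H\<^esub> g) a)" if a: "a \<in> U" for a
  proof (rule continuous_map_locally_constant)
    show "(\<lambda>g. (inv\<^bsub>H\<^esub> g) a) \<in> topspace TG \<rightarrow> U"
      using a by (simp add: inv_H G_Aut)
    fix g assume "g \<in> topspace TG"
    then have g: "g \<in> G"
      by simp
    \<comment> \<open>Any \<open>g'\<close> that agrees with \<open>g\<close> at this preimage of
      \<open>a\<close> has the same inverse at \<open>a\<close>.\<close>
    let ?b = "inv_into U g a"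
    let ?W = "{g' \<in> G. \<forall>c\<in>{?b}. g' c = g c}"
    have b: "?b \<in> U" "g ?b = a"
      using g a G_Aut by simp_all
    have "openin TG ?W"
      using b by (intro openin_TG) simp_all
    moreover have "g \<in> ?W"
      using g by simp
    moreover have "(inv\<^bsub>H\<^esub> g') a = (inv\<^bsub>H\<^esub> g) a" if "g' \<in> ?W" for g'
      using that g a b Aut_inv_eq[of g' ?b a] by (simp add: inv_H G_Aut)
    ultimately show "\<exists>W. openin TG W \<and> g \<in> W \<and> (\<forall>g'\<in>W. (inv\<^bsub>H\<^esub> g') a = (inv\<^bsub>H\<^esub> g) a)"
      by (intro exI[of _ ?W] conjI ballI)
  qed
  moreover have "(\<lambda>g. inv\<^bsub>H\<^esub> g) ` topspace TG \<subseteq> G"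
    using G_inv by (auto simp: inv_H)
  ultimately show "continuous_map TG TG (\<lambda>g. inv\<^bsub>H\<^esub> g)"
    by (intro continuous_map_into_TG) (simp only: image_subset_iff_funcset)
qed

section \<open>The action on normal orderings\<close>

lemma act_eq:
  "R \<in> NO \<Longrightarrow> a \<in> U \<Longrightarrow> b \<in> U \<Longrightarrow> act g R (a, b) = R (inv_into U g a, inv_into U g b)"
  by (simp add: normal_orderings_action_def)

lemma act_extensional: "R \<in> NO \<Longrightarrow> act g R \<in> extensional (U \<times> U)"
  by (simp add: normal_orderings_action_def)

lemma act_NO:
  assumes g: "g \<in> Aut" and R: "R \<in> NO"
  shows "act g R \<in> NO"
  unfolding NO_iff
proof (intro conjI ballI)
  show "act g R \<in> extensional (U \<times> U)"
    by (rule act_extensional[OF R])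
  fix S assume S: "S \<in> \<S>"
  let ?h = "restrict (inv_into U g) U"
  have h: "?h \<in> Aut"
    by (rule Aut_inv[OF g])
  obtain C where C: "C \<in> K" "isomorphic OL (expand (induced A (?h ` S)) R) C"
    using R Aut_image(2)[OF h S] NO_iff by metis
  have "a \<in> U" if "a \<in> S" for a
    using that fg_subset[OF S] by blast
  then have "isomorphism OL ?h (expand (induced A S) (act g R)) (expand (induced A (?h ` S)) R)"
    using Aut_image(1)[OF h S] R by (simp add: isomorphism_expand act_eq)
  then have "isomorphic OL (expand (induced A S) (act g R)) C"
    using isomorphic_trans[OF isomorphicI C(2)] by blast
  then show "\<exists>C\<in>K. isomorphic OL (expand (induced A S) (act g R)) C"
    using C(1) by blast
qed

lemma NO_eqI:
  assumes "R \<in> NO" "R' \<in> NO" "\<And>a b. a \<in> U \<Longrightarrow> b \<in> U \<Longrightarrow> R (a, b) = R' (a, b)"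
  shows "R = R'"
  by (rule extensionalityI[of _ "U \<times> U"]) (use assms in \<open>auto simp: NO_iff\<close>)

lemma act_compose:
  assumes "g \<in> Aut" "h \<in> Aut" "R \<in> NO"
  shows "act (compose U g h) R = act g (act h R)"
proof (rule NO_eqI)
  fix a b assume "a \<in> U" "b \<in> U"
  moreover have "inv_into U (compose U g h) c = inv_into U h (inv_into U g c)" if "c \<in> U" for c
    using that assms Aut_compose by (intro Aut_inv_eq) (simp_all add: compose_def)
  ultimately show "act (compose U g h) R (a, b) = act g (act h R) (a, b)"
    using assms by (simp add: act_eq act_NO)
qed (simp_all add: assms act_NO Aut_compose)

lemma act_one: "R \<in> NO \<Longrightarrow> act (\<lambda>x\<in>U. x) R = R"
proof (rule NO_eqI)
  assume R: "R \<in> NO"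
  fix a b assume "a \<in> U" "b \<in> U"
  moreover have "inv_into U (\<lambda>x\<in>U. x) c = c" if "c \<in> U" for c
    using that by (intro Aut_inv_eq[OF Aut_id]) simp_all
  ultimately show "act (\<lambda>x\<in>U. x) R (a, b) = R (a, b)"
    using R by (simp add: act_eq)
qed (simp_all add: act_NO Aut_id)

lemma act_inv_eq:
  assumes "g \<in> Aut" "R \<in> NO" "a \<in> U" "b \<in> U"
  shows "act (restrict (inv_into U g) U) R (a, b) = R (g a, g b)"
proof -
  have "inv_into U (restrict (inv_into U g) U) c = g c" if "c \<in> U" for c
    using that assms(1) by (intro Aut_inv_eq[OF Aut_inv]) simp_all
  then show ?thesis
    using assms by (simp add: act_eq)
qed

lemma compose_inv:
  assumes "g \<in> Aut"
  shows "compose U g (restrict (inv_into U g) U) = (\<lambda>x\<in>U. x)"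
    and "compose U (restrict (inv_into U g) U) g = (\<lambda>x\<in>U. x)"
  using assms by (auto simp: compose_def fun_eq_iff)

lemma act_Bij:
  assumes g: "g \<in> Aut"
  shows "act g \<in> Bij NO"
proof -
  let ?h = "restrict (inv_into U g) U"
  have h: "?h \<in> Aut"
    by (rule Aut_inv[OF g])
  have "bij_betw (act g) NO NO"
  proof (rule bij_betwI)
    show "act g \<in> NO \<rightarrow> NO" "act ?h \<in> NO \<rightarrow> NO"
      using act_NO g h by blast+
    show "act ?h (act g R) = R" "act g (act ?h R) = R" if "R \<in> NO" for R
      using that by (simp_all add: act_compose[symmetric] act_one g h compose_inv)
  qed
  moreover have "act g \<in> extensional NO"
    by (simp add: normal_orderings_action_def)
  ultimately show ?thesis
    by (simp add: Bij_def)
qed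

lemma group_action_act: "group_action H NO act"
  unfolding group_action_def group_hom_def group_hom_axioms_def
proof (intro conjI)
  show "group H" "group (BijGroup NO)"
    by (simp_all add: group_H group_BijGroup)
  show "act \<in> hom H (BijGroup NO)"
  proof (rule homI)
    show "act g \<in> carrier (BijGroup NO)" if "g \<in> carrier H" for g
      using that act_Bij G_Aut by (simp add: BijGroup_def)
    fix g h assume gh: "g \<in> carrier H" "h \<in> carrier H"
    then have "act g \<otimes>\<^bsub>BijGroup NO\<^esub> act h = compose NO (act g) (act h)"
      using act_Bij G_Aut by (simp add: BijGroup_def)
    also have "\<dots> = act (compose U g h)"
    proof (rule extensionalityI[of _ NO])
      show "act (compose U g h) \<in> extensional NO"
        by (simp add: normal_orderings_action_def)
    qed (use gh in \<open>simp_all add: act_compose G_Aut compose_eq\<close>)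
    finally show "act (g \<otimes>\<^bsub>H\<^esub> h) = act g \<otimes>\<^bsub>BijGroup NO\<^esub> act h"
      using gh by (simp add: mult_H)
  qed
qed

lemma TN_eq: "TN = subtopology TP NO"
  by (simp add: normal_orderings_topology_def)

lemma continuous_act: "continuous_map (prod_topology TG TN) TN (\<lambda>(g, R). act g R)"
proof -
  have "continuous_map (prod_topology TG TN) (discrete_topology UNIV)
      (\<lambda>x. (case x of (g, R) \<Rightarrow> act g R) p)"
    if "p \<in> U \<times> U" for p
  proof (rule continuous_map_locally_constant)
    obtain a b where p: "p = (a, b)" and ab: "a \<in> U" "b \<in> U"
      using \<open>p \<in> U \<times> U\<close> by auto
    fix x assume "x \<in> topspace (prod_topology TG TN)"
    then obtain g R where x: "x = (g, R)" "g \<in> G" "R \<in> NO"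
      by auto
    \<comment> \<open>The value of \<open>act g R\<close> at \<open>(a, b)\<close> is the value of
      \<open>R\<close> at \<open>(?u, ?v)\<close>. Fixing \<open>g\<close> at these two points and
      \<open>R\<close> at this one pair fixes it.\<close>
    let ?u = "inv_into U g a" and ?v = "inv_into U g b"
    let ?W = "{g' \<in> G. \<forall>b\<in>{?u, ?v}. g' b = g b} \<times> {R' \<in> NO. \<forall>q\<in>{(?u, ?v)}. R' q = R q}"
    have "openin (prod_topology TG TN) ?W"
      using ab x G_Aut
      by (intro openin_prod_Times_iff[THEN iffD2] disjI2 conjI openin_TG openin_TN) simp_all
    moreover have "x \<in> ?W"
      using x by simp
    moreover have "(case y of (g, R) \<Rightarrow> act g R) p = (case x of (g, R) \<Rightarrow> act g R) p" if y: "y \<in> ?W" for y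
    proof -
      obtain g' R' where y': "y = (g', R')" "g' \<in> G" "R' \<in> NO" "g' ?u = a" "g' ?v = b" "R' (?u, ?v) = R (?u, ?v)"
        using y x ab G_Aut by auto
      have "inv_into U g' a = ?u" "inv_into U g' b = ?v"
        using y' x ab G_Aut by (simp_all add: Aut_inv_eq)
      then show ?thesis
        using x y' ab p by (simp add: act_eq)
    qed
    ultimately show "\<exists>W. openin (prod_topology TG TN) W \<and> x \<in> W \<and>
        (\<forall>y\<in>W. (case y of (g, R) \<Rightarrow> act g R) p = (case x of (g, R) \<Rightarrow> act g R) p)"
      by (intro exI[of _ ?W] conjI ballI)
  qed simp
  moreover have "(\<lambda>(g, R). act g R) ` topspace (prod_topology TG TN) \<subseteq> NO"
    using act_NO G_Aut by auto
  moreover have "NO \<subseteq> extensional (U \<times> U)"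
    by (auto simp: NO_iff)
  ultimately show ?thesis
    unfolding TN_eq[THEN arg_cong, of "\<lambda>T. continuous_map (prod_topology TG TN) T (\<lambda>(g, R). act g R)"]
      continuous_map_in_subtopology continuous_map_componentwise
    by (auto simp: image_subset_iff)
qed

lemma flow_NO: "flow H TG TN act"
  unfolding flow_def
  using topological_group_H compact_space_TN Hausdorff_space_TN group_action_act continuous_act
  by simp

section \<open>Dense orbits and minimality\<close>

text \<open>Order forgetfulness, applied to \<open>S\<close> with itself, gives an automorphism of
  \<open>S\<close> carrying \<open>R'\<close> to \<open>R\<close>. The action pulls orderings back
  along inverses, so the witness is the inverse of an element of \<open>G\<close> extending
  it.\<close>

lemma orbit_dense:
  assumes R: "R \<in> NO" "R' \<in> NO" and S: "S \<in> \<S>"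
  obtains g where "g \<in> G" "\<And>a b. a \<in> S \<Longrightarrow> b \<in> S \<Longrightarrow> act g R (a, b) = R' (a, b)"
proof -
  obtain p where p: "isomorphism L p (induced A S) (induced A S)"
    "\<And>a b. a \<in> S \<Longrightarrow> b \<in> S \<Longrightarrow> R' (a, b) \<longleftrightarrow> R (p a, p b)"
    using NO_isomorphism[OF R(2,1) S S isomorphic_refl] by metis
  obtain g where g: "g \<in> G" "\<And>x. x \<in> S \<Longrightarrow> g x = p x"
    using G_extend[OF S S p(1)] by metis
  let ?h = "restrict (inv_into U g) U"
  have "act ?h R (a, b) = R' (a, b)" if "a \<in> S" "b \<in> S" for a b
  proof -
    have "a \<in> U" "b \<in> U"
      using that fg_subset[OF S] by blast+
    then have "act ?h R (a, b) = R (g a, g b)"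
      using act_inv_eq G_Aut g(1) R(1) by simp
    then show ?thesis
      using p(2) g(2) that by simp
  qed
  with G_inv[OF g(1)] show thesis
    by (rule that)
qed

lemma minimal_NO: "minimal_flow H TG TN act"
  unfolding minimal_flow_def
proof (intro conjI allI impI)
  show "flow H TG TN act"
    by (rule flow_NO)
  show "topspace TN \<noteq> {}"
    using NO_nonempty by simp
  fix C assume C: "closedin TN C \<and> C \<noteq> {} \<and> (\<forall>g\<in>carrier H. act g ` C \<subseteq> C)"
  then obtain R where R: "R \<in> C" "R \<in> NO"
    using closedin_subset[of TN C] by auto
  have "R' \<in> C" if R': "R' \<in> NO" for R'
  proof (rule ccontr)
    assume "R' \<notin> C"
    then have "R' \<in> NO - C"
      using R' by simp
    moreover have "openin TN (NO - C)"
      using C by (simp add: closedin_def)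
    ultimately obtain S where S: "S \<in> \<S>"
      "\<And>R''. R'' \<in> NO \<Longrightarrow> (\<And>a b. a \<in> S \<Longrightarrow> b \<in> S \<Longrightarrow> R'' (a, b) = R' (a, b)) \<Longrightarrow> R'' \<in> NO - C"
      using TN_basis by metis
    obtain g where g: "g \<in> G" "\<And>a b. a \<in> S \<Longrightarrow> b \<in> S \<Longrightarrow> act g R (a, b) = R' (a, b)"
      using orbit_dense[OF R(2) R' S(1)] by metis
    have "act g R \<in> NO"
      using act_NO G_Aut g(1) R(2) by simp
    then have "act g R \<notin> C"
      using S(2)[of "act g R"] g(2) by simp
    moreover have "act g R \<in> C"
      using C R(1) g(1) by (auto simp: image_subset_iff)
    ultimately show False
      by contradiction
  qed
  then show "C = topspace TN"
    using C closedin_subset[of TN C] by auto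
qed

end

section \<open>Universality\<close>

text \<open>An isomorphism matches the copies of \<open>S\<close> below \<open>B\<close> with those
  below \<open>h\<close>
  B\<open>, so homogeneity of the pulled-back colouring on\<close>B\<open>passes to\<close>c\<open>on\<close>h
  \<open>B\<close>.\<close>

lemma monochromatic_transfer:
  assumes h: "isomorphism L h C D" "is_structure L C"
    and mono: "\<And>T. T \<subseteq> B \<Longrightarrow> isomorphic L S (induced C T) \<Longrightarrow> c (h ` T) = i"
    and B: "B \<subseteq> univ C" and T: "T \<subseteq> h ` B" "isomorphic L S (induced D T)"
  shows "c T = i"
proof -
  let ?k = "inv_into (univ C) h"
  have inj: "inj_on h (univ C)" and im: "h ` univ C = univ D"
    using h by (auto simp: isomorphism_def embedding_def)
  have "T \<subseteq> univ D"
    using T B im by blast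
  then have "isomorphism L ?k (induced D T) (induced C (?k ` T))"
    by (rule isomorphism_induced[OF isomorphism_inv[OF h]])
  from isomorphic_trans[OF T(2) isomorphicI[OF this]]
  have "isomorphic L S (induced C (?k ` T))" .
  moreover have "?k ` T \<subseteq> B"
  proof
    fix x assume "x \<in> ?k ` T"
    then obtain b where "b \<in> B" "x = ?k (h b)"
      using T(1) by blast
    then show "x \<in> B"
      using inj B by (simp add: subset_iff)
  qed
  ultimately have "c (h ` (?k ` T)) = i"
    by (rule_tac mono)
  moreover have "h ` (?k ` T) = T"
    using \<open>T \<subseteq> univ D\<close> im by (auto simp: image_image f_inv_into_f subset_iff)
  ultimately show ?thesis
    by simp
qed

locale ramsey_automorphism_group = dense_automorphism_group L A K G
  for L :: "('f, 'r) language"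
    and A :: "('f, 'r, 'a) struct"
    and K :: "('f, 'r option, nat) struct set"
    and G :: "('a \<Rightarrow> 'a) set" +
  assumes ramsey: "ramsey_property L (age L A :: ('f, 'r, nat) struct set)"
begin

lemma age_representative:
  assumes S: "S \<in> \<S>"
  obtains B :: "('f, 'r, nat) struct" where "B \<in> age L A" "is_structure L B"
    "isomorphic L (induced A S) B" "isomorphic L B (induced A S)"
proof -
  obtain B :: "('f, 'r, nat) struct" where B: "is_structure L B" "isomorphic L (induced A S) B"
    using finite_structure_nat[of L "induced A S"] S fg_structure fg_finite by auto
  then have iso: "isomorphic L B (induced A S)"
    using S fg_structure isomorphic_sym by blast
  then have "B \<in> age L A"
    using B S by (auto simp: age_def)
  from this B iso show thesis
    by (rule that)
qed

lemma isomorphic_image: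
  assumes h: "isomorphism L h (induced A D) B" and iso: "isomorphic L C (induced A S)" and S: "S \<subseteq> D"
  shows "isomorphic L C (induced B (h ` S))"
proof -
  have "isomorphism L h (induced A S) (induced B (h ` S))"
    using isomorphism_induced[OF h, of S] S by simp
  from isomorphic_trans[OF iso isomorphicI[OF this]] show ?thesis .
qed

text \<open>The Ramsey property transported from representatives on natural numbers to substructures
  of \<open>A\<close>, with two colours. One \<open>D\<close> serves all colourings
  \<open>c\<close>; the induction for several colourings depends on this order of
  quantifiers.\<close>

lemma ramsey_copies:
  assumes S: "S \<in> \<S>" and B: "B \<in> \<S>"
  shows "\<exists>D\<in>\<S>. \<forall>c :: 'a set \<Rightarrow> bool. \<exists>B'\<subseteq>D. isomorphic L (induced A B) (induced A B') \<and>
    (\<exists>i. \<forall>T\<subseteq>B'. isomorphic L (induced A S) (induced A T) \<longrightarrow> c T = i)"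
proof (cases "embeds L (induced A S) (induced A B)")
  case False
  \<comment> \<open>Without an embedding of \<open>S\<close> the Ramsey property says nothing, but
    then \<open>B\<close> contains no copies of \<open>S\<close> and is vacuously
    monochromatic.\<close>
  have "\<not> isomorphic L (induced A S) (induced A T)" if T: "T \<subseteq> B" for T
  proof
    assume "isomorphic L (induced A S) (induced A T)"
    then obtain h where "isomorphism L h (induced A S) (induced A T)"
      by (auto simp: isomorphic_def)
    then have "embedding L h (induced A S) (induced A B)"
      using T by (auto simp: isomorphism_def embedding_def)
    then show False
      using False by (auto simp: embeds_def)
  qed
  then show ?thesis
    using B isomorphic_refl by (intro bexI[of _ B] allI exI[of _ B] conjI) auto
next
  case True
  obtain S1 :: "('f, 'r, nat) struct" where S1: "S1 \<in> age L A" "is_structure L S1"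
    "isomorphic L (induced A S) S1" "isomorphic L S1 (induced A S)"
    by (rule age_representative[OF S])
  obtain B1 :: "('f, 'r, nat) struct" where B1: "B1 \<in> age L A" "is_structure L B1"
    "isomorphic L (induced A B) B1" "isomorphic L B1 (induced A B)"
    by (rule age_representative[OF B])
  have "embeds L S1 B1"
  proof -
    obtain e where e: "embedding L e (induced A S) (induced A B)"
      using True by (auto simp: embeds_def)
    obtain s where s: "embedding L s S1 (induced A S)"
      using S1(4) by (auto simp: isomorphic_def isomorphism_def)
    obtain b where b: "embedding L b (induced A B) B1"
      using B1(3) by (auto simp: isomorphic_def isomorphism_def)
    show ?thesis
      using embedding_comp[OF embedding_comp[OF s e] b] by (auto simp: embeds_def)
  qed
  then obtain C :: "('f, 'r, nat) struct" where C: "C \<in> age L A" and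
    mono: "\<forall>c. c \<in> copies L S1 C \<rightarrow> {..<2::nat} \<longrightarrow>
      (\<exists>B'\<in>copies L B1 C. \<exists>i. \<forall>A'\<in>copies L S1 (induced C B'). c A' = i)"
    using ramsey[unfolded ramsey_property_def, rule_format, OF S1(1) B1(1) _ order_refl] by blast
  obtain D h where D: "D \<in> \<S>" and h: "isomorphism L h C (induced A D)" and Cs: "is_structure L C"
    using C by (auto simp: age_def isomorphic_def)
  have hD: "h ` univ C = D"
    using h by (simp add: isomorphism_def)
  show ?thesis
  proof (intro bexI[OF _ D] allI)
    fix c :: "'a set \<Rightarrow> bool"
    define c1 :: "nat set \<Rightarrow> nat" where "c1 T = (if c (h ` T) then 1 else 0)" for T
    have "c1 \<in> copies L S1 C \<rightarrow> {..<2}"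
      by (simp add: c1_def)
    from mono[rule_format, OF this] obtain B' i where B': "B' \<in> copies L B1 C"
      and i: "\<forall>T\<in>copies L S1 (induced C B'). c1 T = i"
      by (elim bexE exE)
    have sub: "B' \<subseteq> univ C" and iso: "isomorphic L B1 (induced C B')"
      using B' by (auto simp: copies_def substructures_def)
    have "isomorphism L h (induced C B') (induced A (h ` B'))"
      using isomorphism_induced[OF h sub] by simp
    from isomorphic_trans[OF isomorphic_trans[OF B1(3) iso] isomorphicI[OF this]]
    have "isomorphic L (induced A B) (induced A (h ` B'))" .
    moreover have "c T = (i = 1)"
      if T: "T \<subseteq> h ` B'" "isomorphic L (induced A S) (induced A T)" for T
    proof (rule monochromatic_transfer[OF h Cs _ sub T(1)])
      show "isomorphic L S1 (induced (induced A D) T)"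
        using isomorphic_trans[OF S1(4) T(2)] by simp
      fix T assume T: "T \<subseteq> B'" "isomorphic L S1 (induced C T)"
      have "is_structure L (induced C T)"
        by (rule isomorphic_is_structure[OF T(2) S1(2)])
      then have "T \<in> copies L S1 (induced C B')"
        using T by (simp add: copies_def substructures_def)
      from bspec[OF i this] show "c (h ` T) = (i = 1)"
        unfolding c1_def by (simp split: if_splits)
    qed
    ultimately show "\<exists>B'\<subseteq>D. isomorphic L (induced A B) (induced A B') \<and>
        (\<exists>i. \<forall>T\<subseteq>B'. isomorphic L (induced A S) (induced A T) \<longrightarrow> c T = i)"
      using hD sub by (intro exI[of _ "h ` B'"] conjI exI[of _ "i = 1"]) auto
  qed
qed

text \<open>To treat one more pair \<open>(S, c)\<close>, pick \<open>D\<close> for \<open>S\<close>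
  and \<open>B\<close> before looking at \<open>c\<close>, and let the induction hypothesis supply a
  copy \<open>D'\<close> of \<open>D\<close> good for the pairs in \<open>J\<close>. Pulling
  \<open>c\<close> back to \<open>D\<close> yields a copy of \<open>B\<close> in \<open>D\<close>,
  whose image in \<open>D'\<close> is good for all pairs, since monochromaticity is inherited by
  subsets.\<close>

lemma ramsey_finitely_many:
  fixes J :: "('a set \<times> ('a set \<Rightarrow> bool)) set"
  assumes "finite J" "\<And>S c. (S, c) \<in> J \<Longrightarrow> S \<in> \<S>" "B \<in> \<S>"
  shows "\<exists>B'\<in>\<S>. isomorphic L (induced A B) (induced A B') \<and>
    (\<forall>(S, c)\<in>J. \<exists>i. \<forall>T\<subseteq>B'. isomorphic L (induced A S) (induced A T) \<longrightarrow> c T = i)"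
  using assms
proof (induction J arbitrary: B rule: finite_induct)
  case empty
  then show ?case
    using isomorphic_refl by (intro bexI[of _ B]) auto
next
  case (insert x J)
  obtain S c where x: "x = (S, c)"
    by (cases x)
  have S: "S \<in> \<S>"
    using insert.prems(1) x by blast
  obtain D where D: "D \<in> \<S>" and
    mono: "\<And>c :: 'a set \<Rightarrow> bool. \<exists>B'\<subseteq>D. isomorphic L (induced A B) (induced A B') \<and>
    (\<exists>i. \<forall>T\<subseteq>B'. isomorphic L (induced A S) (induced A T) \<longrightarrow> c T = i)"
    using ramsey_copies[OF S insert.prems(2)] by metis
  have "\<exists>D'\<in>\<S>. isomorphic L (induced A D) (induced A D') \<and>
    (\<forall>(S, c)\<in>J. \<exists>i. \<forall>T\<subseteq>D'. isomorphic L (induced A S) (induced A T) \<longrightarrow> c T = i)"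
    by (rule insert.IH[OF insert.prems(1)[OF insertI2] D])
  then obtain D' h where D': "D' \<in> \<S>" and h: "isomorphism L h (induced A D) (induced A D')"
    and J: "\<forall>(S, c)\<in>J. \<exists>i. \<forall>T\<subseteq>D'. isomorphic L (induced A S) (induced A T) \<longrightarrow> c T = i"
    unfolding isomorphic_def by (elim bexE conjE exE) simp
  obtain B' i where B': "B' \<subseteq> D" "isomorphic L (induced A B) (induced A B')"
    and i: "\<And>T. T \<subseteq> B' \<Longrightarrow> isomorphic L (induced A S) (induced A T) \<Longrightarrow> c (h ` T) = i"
    using mono[of "\<lambda>T. c (h ` T)"] by metis
  have sub: "h ` B' \<subseteq> D'"
    using B'(1) h by (auto simp: isomorphism_def)
  have iso: "isomorphic L (induced A B) (induced A (h ` B'))"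
    using isomorphic_image[OF h B'(2,1)] by simp
  have "is_structure L (induced A (h ` B'))"
    by (rule isomorphic_is_structure[OF iso fg_structure[OF insert.prems(2)]])
  with D' sub have "h ` B' \<in> \<S>"
    by (rule fg_sub)
  moreover note iso
  moreover have "\<exists>i. \<forall>T\<subseteq>h ` B'. isomorphic L (induced A S') (induced A T) \<longrightarrow> c' T = i"
    if "(S', c') \<in> insert x J" for S' c'
  proof (cases "(S', c') \<in> J")
    case True
    from bspec[OF J this] obtain i
      where "\<forall>T\<subseteq>D'. isomorphic L (induced A S') (induced A T) \<longrightarrow> c' T = i"
      unfolding prod.case by (elim exE)
    then show ?thesis
      using sub by (intro exI[of _ i]) (meson order_trans)
  next
    case False
    then have eq: "S' = S" "c' = c"
      using that x by simp_all
    have "c T = i" if T: "T \<subseteq> h ` B'" "isomorphic L (induced A S) (induced A T)" for T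
      by (rule monochromatic_transfer[OF h fg_structure[OF D], of B' "induced A S" c i])
        (use i B'(1) T in simp_all)
    then show ?thesis
      unfolding eq by metis
  qed
  ultimately show ?case
    by (intro bexI[of _ "h ` B'"] conjI ballI) auto
qed

end

section \<open>Separation of sets in a minimal flow \<open>Y\<close>\<close>

locale ramsey_minimal_flow = ramsey_automorphism_group L A K G
  for L :: "('f, 'r) language"
    and A :: "('f, 'r, 'a) struct"
    and K :: "('f, 'r option, nat) struct set"
    and G :: "('a \<Rightarrow> 'a) set" +
  fixes Y :: "'y topology" and \<psi> :: "('a \<Rightarrow> 'a) \<Rightarrow> 'y \<Rightarrow> 'y"
    and R :: "'a \<times> 'a \<Rightarrow> bool"
  assumes minimal_Y: "minimal_flow H TG Y \<psi>"
    and R: "R \<in> NO"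
begin

lemma compact_Y: "compact_space Y" and Hausdorff_Y: "Hausdorff_space Y"
  and nonempty_Y: "topspace Y \<noteq> {}"
  and group_action_\<psi>: "group_action H (topspace Y) \<psi>"
  and continuous_joint: "continuous_map (prod_topology TG Y) Y (\<lambda>(g, y). \<psi> g y)"
  using minimal_Y by (simp_all add: minimal_flow_def flow_def)

lemma \<psi>_mem [simp]: "g \<in> G \<Longrightarrow> y \<in> topspace Y \<Longrightarrow> \<psi> g y \<in> topspace Y"
  using group_action.element_image[OF group_action_\<psi>] by simp

lemma \<psi>_compose: "g \<in> G \<Longrightarrow> h \<in> G \<Longrightarrow> y \<in> topspace Y \<Longrightarrow> \<psi> (compose U g h) y = \<psi> g (\<psi> h y)"
  using group_action.composition_rule[OF group_action_\<psi>, of y g h] by (simp add: mult_H)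

lemma \<psi>_one: "y \<in> topspace Y \<Longrightarrow> \<psi> (\<lambda>x\<in>U. x) y = y"
  using group_action.id_eq_one[OF group_action_\<psi>] one_H by (metis restrict_apply')

lemma continuous_\<psi>:
  assumes "g \<in> G"
  shows "continuous_map Y Y (\<psi> g)"
proof -
  have "continuous_map Y (prod_topology TG Y) (\<lambda>y. (g, y))"
    using assms topspace_TG by (intro continuous_map_pairedI) (simp_all del: topspace_subtopology)
  from continuous_map_compose[OF this continuous_joint] show ?thesis
    by (simp add: comp_def)
qed

text \<open>A substitute for uniform closeness: the elements of \<open>G\<close> fixing
  \<open>S\<close> pointwise form a basic neighbourhood of the identity, too small to carry
  \<open>P\<close> into \<open>Q\<close>.\<close>

definition separates :: "'a set \<Rightarrow> 'y set \<Rightarrow> 'y set \<Rightarrow> bool" where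
  "separates S P Q \<longleftrightarrow> S \<in> \<S> \<and>
    (\<forall>v\<in>G. (\<forall>x\<in>S. v x = x) \<longrightarrow> (\<forall>y\<in>topspace Y. \<not> (y \<in> P \<and> \<psi> v y \<in> Q)))"

text \<open>The pairs \<open>(g, y)\<close> with \<open>y\<close> in \<open>P\<close> and
  \<open>\<psi> g y\<close> in \<open>Q\<close> form a closed set. Its projection to
  \<open>G\<close> is closed because \<open>Y\<close> is compact, and it misses the identity because
  \<open>P\<close> and \<open>Q\<close> are disjoint.\<close>

lemma separates_exists:
  assumes P: "closedin Y P" and Q: "closedin Y Q" and disj: "P \<inter> Q = {}"
  obtains S where "separates S P Q"
proof -
  let ?X = "prod_topology TG Y"
  let ?C = "{z \<in> topspace ?X. snd z \<in> P} \<inter> {z \<in> topspace ?X. (case z of (g, y) \<Rightarrow> \<psi> g y) \<in> Q}"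
  have "closedin ?X ?C"
    by (intro closedin_Int closedin_continuous_map_preimage[OF continuous_map_snd P]
        closedin_continuous_map_preimage[OF continuous_joint Q])
  then have "closedin TG (fst ` ?C)"
    using Abstract_Topological_Spaces.closed_map_fst[OF compact_Y] unfolding closed_map_def by blast
  then have op: "openin TG (G - fst ` ?C)"
    using topspace_TG unfolding closedin_def by simp
  have mem: "(\<lambda>x\<in>U. x) \<in> G - fst ` ?C"
    using G_one disj \<psi>_one by auto
  define N where "N = fst ` ?C"
  obtain S where S: "S \<in> \<S>"
    "\<And>g. g \<in> G \<Longrightarrow> (\<And>x. x \<in> S \<Longrightarrow> g x = (\<lambda>x\<in>U. x) x) \<Longrightarrow> g \<in> G - N"
    using TG_basis[OF op mem] unfolding N_def[symmetric] by metis
  have "\<not> (y \<in> P \<and> \<psi> v y \<in> Q)" if v: "v \<in> G" "\<forall>x\<in>S. v x = x" and y: "y \<in> topspace Y" for v y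
  proof
    assume "y \<in> P \<and> \<psi> v y \<in> Q"
    then have vy: "(v, y) \<in> ?C"
      using v(1) y topspace_TG by (simp del: topspace_subtopology)
    have "v \<in> N"
      unfolding N_def by (rule image_eqI[OF _ vy]) (simp only: fst_conv)
    moreover have "v x = (\<lambda>x\<in>U. x) x" if "x \<in> S" for x
      using that v(2) fg_subset[OF S(1)] by auto
    from S(2)[OF v(1) this] have "v \<notin> N"
      by simp
    ultimately show False
      by contradiction
  qed
  with S(1) have "separates S P Q"
    unfolding separates_def by metis
  then show thesis
    by (rule that)
qed

text \<open>\<open>\<psi> g y\<close> depends on \<open>g\<close>, up to the precision needed to tell \<open>P\<close> from \<open>Q\<close>, only through the
  embedding of \<open>S\<close> into \<open>A\<close> given by the inverse of \<open>g\<close>. Ordering the copies of \<open>S\<close> by \<open>R\<close> singles out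
  at most one embedding onto each copy, so that the Ramsey property applies.\<close>

definition colour :: "'y \<Rightarrow> 'a set \<Rightarrow> 'y set \<Rightarrow> ('a \<times> 'a \<Rightarrow> bool) \<Rightarrow> 'a set \<Rightarrow> bool" where
  "colour y S P Q T \<longleftrightarrow> (\<exists>e. isomorphism L e (induced A S) (induced A T) \<and>
     (\<forall>a\<in>S. \<forall>b\<in>S. Q (a, b) \<longleftrightarrow> R (e a, e b)) \<and>
     (\<exists>g\<in>G. (\<forall>x\<in>S. g (e x) = x) \<and> \<psi> g y \<in> P))"

lemma colour_mono:
  assumes y: "y \<in> topspace Y" and sep: "separates S P Q" and B: "B \<in> \<S>"
    and i: "\<And>T. T \<subseteq> k ` B \<Longrightarrow> isomorphic L (induced A S) (induced A T) \<Longrightarrow>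
      colour y S P (act g R) T = i"
    and k: "k \<in> G" "\<And>a b. a \<in> B \<Longrightarrow> b \<in> B \<Longrightarrow> R (a, b) \<longleftrightarrow> R (k a, k b)"
    and gh: "g \<in> G" "h \<in> G" "inv_into U g ` S \<subseteq> B" "inv_into U h ` S \<subseteq> B"
    and eq: "\<And>a b. a \<in> S \<Longrightarrow> b \<in> S \<Longrightarrow> act g R (a, b) = act h R (a, b)"
  shows "\<not> (\<psi> (compose U g (restrict (inv_into U k) U)) y \<in> P \<and>
    \<psi> (compose U h (restrict (inv_into U k) U)) y \<in> Q)"
proof
  assume PQ: "\<psi> (compose U g (restrict (inv_into U k) U)) y \<in> P \<and>
    \<psi> (compose U h (restrict (inv_into U k) U)) y \<in> Q"
  have S: "S \<in> \<S>"
    using sep by (simp add: separates_def)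
  have SU: "x \<in> U" if "x \<in> S" for x
    using that fg_subset[OF S] by blast
  define e where "e f = compose U k (restrict (inv_into U f) U)" for f
  have e_Aut: "e f \<in> Aut" if "f \<in> G" for f
    using that k(1) by (simp add: e_def Aut_compose Aut_inv G_Aut)
  have e: "e f x = k (inv_into U f x)" if "x \<in> S" for f x
    using SU[OF that] by (simp add: e_def compose_def)
  have e_inv: "compose U f (restrict (inv_into U k) U) (e f x) = x" if "f \<in> G" "x \<in> S" for f x
    using that SU k(1) by (simp add: e compose_def G_Aut)
  have e_iso: "isomorphism L (e f) (induced A S) (induced A (e f ` S))" if "f \<in> G" for f
    by (rule Aut_image(1)[OF e_Aut[OF that] S])
  have e_sub: "e f ` S \<subseteq> k ` B" if "inv_into U f ` S \<subseteq> B" for f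
    using that e by (auto simp: image_subset_iff)
  have e_R: "act f R (a, b) \<longleftrightarrow> R (e f a, e f b)" if "inv_into U f ` S \<subseteq> B" "a \<in> S" "b \<in> S" for f a b
    using that R SU k(2)[of "inv_into U f a" "inv_into U f b"]
    by (simp add: act_eq e image_subset_iff)
  have comp: "compose U f (restrict (inv_into U k) U) \<in> G" if "f \<in> G" for f
    using that k(1) by (simp add: G_compose G_inv)
  have "colour y S P (act g R) (e g ` S)"
    unfolding colour_def
    using e_iso[OF gh(1)] e_R[OF gh(3)] comp[OF gh(1)] e_inv[OF gh(1)] PQ by metis
  moreover have "colour y S P (act g R) (e g ` S) = i" "colour y S P (act g R) (e h ` S) = i"
    by (rule i; use e_sub gh e_iso isomorphicI in metis)+
  ultimately have "colour y S P (act g R) (e h ` S)"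
    by simp
  then obtain e' g' where e': "isomorphism L e' (induced A S) (induced A (e h ` S))"
    "\<forall>a\<in>S. \<forall>b\<in>S. act g R (a, b) \<longleftrightarrow> R (e' a, e' b)"
    and g': "g' \<in> G" "\<forall>x\<in>S. g' (e' x) = x" "\<psi> g' y \<in> P"
    unfolding colour_def by (elim exE bexE conjE)
  have e'_eq: "e' x = e h x" if x: "x \<in> S" for x
  proof (rule linear_ordering_rigid[OF fg_finite[OF S] _ _ _ _ _ _ x])
    show "linear_ordering S (act g R)"
      by (rule NO_linear[OF act_NO[OF G_Aut[OF gh(1)] R] fg_subset[OF S]])
    have "e h ` S \<subseteq> U"
      using SU e_Aut[OF gh(2)] by auto
    then show "linear_ordering (e h ` S) R"
      by (rule NO_linear[OF R])
    show "bij_betw e' S (e h ` S)" "bij_betw (e h) S (e h ` S)"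
      using isomorphism_bij_betw[OF e'(1)] isomorphism_bij_betw[OF e_iso[OF gh(2)]] by simp_all
    fix a b assume ab: "a \<in> S" "b \<in> S"
    show "act g R (a, b) \<longleftrightarrow> R (e' a, e' b)"
      using e'(2) ab by simp
    show "act g R (a, b) \<longleftrightarrow> R (e h a, e h b)"
      using eq[OF ab] e_R[OF gh(4) ab] by simp
  qed
  \<comment> \<open>Both \<open>g'\<close> and \<open>?h\<close> undo \<open>e h\<close> on
    \<open>S\<close>, so their quotient \<open>?v\<close> fixes \<open>S\<close> pointwise while it
    sends \<open>\<psi> g' y\<close> to \<open>\<psi> ?h y\<close>.\<close>
  let ?h = "compose U h (restrict (inv_into U k) U)" and ?g = "restrict (inv_into U g') U"
  let ?v = "compose U ?h ?g"
  have G: "?h \<in> G" "?g \<in> G" "?v \<in> G"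
    using comp[OF gh(2)] G_inv[OF g'(1)] G_compose by blast+
  have "?v x = x" if x: "x \<in> S" for x
  proof -
    have "e h x \<in> U"
      using e_Aut[OF gh(2)] SU[OF x] by simp
    moreover have "g' (e h x) = x"
      using g'(2) e'_eq x by simp
    ultimately have "inv_into U g' x = e h x"
      using Aut_inv_eq G_Aut[OF g'(1)] by blast
    then have "?v x = ?h (e h x)"
      using SU[OF x] by (simp add: compose_def)
    then show ?thesis
      using e_inv[OF gh(2) x] by simp
  qed
  moreover have "\<psi> ?v (\<psi> g' y) = \<psi> ?h (\<psi> (compose U ?g g') y)"
    using G g'(1) y by (simp add: \<psi>_compose)
  then have "\<psi> ?v (\<psi> g' y) = \<psi> ?h y"
    using y G_Aut[OF g'(1)] by (simp add: compose_inv \<psi>_one)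
  ultimately show False
    using sep G(3) PQ g'(1,3) y unfolding separates_def by (metis \<psi>_mem)
qed

section \<open>Construction of the base point \<open>y\<^sub>0\<close>\<close>

text \<open>Each quintuple is one condition on the future \<open>y\<^sub>0\<close>;
  \<open>solutions\<close> collects the points that meet it. Openness of \<open>P\<close> and
  \<open>Q\<close> is there to make those sets closed.\<close>

definition constraints :: "('a set \<times> 'y set \<times> 'y set \<times> ('a \<Rightarrow> 'a) \<times> ('a \<Rightarrow> 'a)) set" where
  "constraints = {(S, P, Q, g, h). separates S P Q \<and> openin Y P \<and> openin Y Q \<and> g \<in> G \<and> h \<in> G \<and>
     (\<forall>a\<in>S. \<forall>b\<in>S. act g R (a, b) = act h R (a, b))}"

definition solutions :: "'a set \<times> 'y set \<times> 'y set \<times> ('a \<Rightarrow> 'a) \<times> ('a \<Rightarrow> 'a) \<Rightarrow> 'y set" where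
  "solutions = (\<lambda>(S, P, Q, g, h). {y \<in> topspace Y. \<not> (\<psi> g y \<in> P \<and> \<psi> h y \<in> Q)})"

lemma solutions_closed:
  assumes "x \<in> constraints"
  shows "closedin Y (solutions x)"
proof -
  obtain S P Q g h where x: "x = (S, P, Q, g, h)"
    by (cases x)
  have PQ: "openin Y P" "openin Y Q" "g \<in> G" "h \<in> G"
    using assms by (simp_all add: x constraints_def)
  have "openin Y ({y \<in> topspace Y. \<psi> g y \<in> P} \<inter> {y \<in> topspace Y. \<psi> h y \<in> Q})"
    using PQ by (intro openin_Int openin_continuous_map_preimage[OF continuous_\<psi>])
  moreover have "{y \<in> topspace Y. \<psi> g y \<in> P} \<inter> {y \<in> topspace Y. \<psi> h y \<in> Q} = topspace Y - solutions x"
    by (auto simp: x solutions_def)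
  ultimately show ?thesis
    by (auto simp: closedin_def x solutions_def)
qed

text \<open>Any point \<open>y\<close> works after translation by the inverse of a suitable
  \<open>k\<close>, which moves a finite set containing all relevant preimages onto a copy
  monochromatic for all the colourings attached to \<open>J\<close>.\<close>

lemma finitely_many_constraints:
  assumes J: "finite J" "J \<subseteq> constraints"
  shows "\<exists>y\<in>topspace Y. \<forall>x\<in>J. y \<in> solutions x"
proof -
  obtain y where y: "y \<in> topspace Y"
    using nonempty_Y by blast
  \<comment> \<open>The restriction of \<open>act g R\<close> to \<open>S\<close> is read off from
    \<open>R\<close> on the preimage of \<open>S\<close> under \<open>g\<close>; \<open>X\<close>
    gathers these preimages.\<close>
  define X where "X = (\<Union>(S, P, Q, g, h)\<in>J. inv_into U g ` S \<union> inv_into U h ` S)"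
  have J': "separates S P Q" "S \<in> \<S>" "g \<in> G" "h \<in> G"
    "\<forall>a\<in>S. \<forall>b\<in>S. act g R (a, b) = act h R (a, b)" if "(S, P, Q, g, h) \<in> J" for S P Q g h
    using subsetD[OF J(2) that] by (simp_all add: constraints_def separates_def)
  have "finite X"
    using J(1) J'(2) fg_finite unfolding X_def by (intro finite_UN_I) auto
  moreover have "X \<subseteq> U"
  proof
    fix x assume "x \<in> X"
    then obtain S P Q g h z where z: "(S, P, Q, g, h) \<in> J" "z \<in> S" "x = inv_into U g z \<or> x = inv_into U h z"
      unfolding X_def by auto
    then have "z \<in> U"
      using J'(2)[OF z(1)] fg_subset by blast
    then show "x \<in> U"
      using z J'(3,4)[OF z(1)] G_Aut by auto
  qed
  ultimately obtain B where B: "B \<in> \<S>" "X \<subseteq> B"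
    by (rule fg_cover)
  let ?f = "\<lambda>(S, P, Q, g, h). (S, colour y S P (act g R))"
  have "\<exists>B'\<in>\<S>. isomorphic L (induced A B) (induced A B') \<and>
    (\<forall>(S, c)\<in>?f ` J. \<exists>i. \<forall>T\<subseteq>B'. isomorphic L (induced A S) (induced A T) \<longrightarrow> c T = i)"
    by (rule ramsey_finitely_many) (use J(1) J'(2) B(1) in auto)
  then obtain B' where B': "B' \<in> \<S>" "isomorphic L (induced A B) (induced A B')"
    and mono: "\<forall>(S, c)\<in>?f ` J. \<exists>i. \<forall>T\<subseteq>B'. isomorphic L (induced A S) (induced A T) \<longrightarrow> c T = i"
    by (elim bexE conjE)
  \<comment> \<open>The Ramsey property ignores orders, so \<open>B'\<close> is only a copy of the
    unordered \<open>B\<close>. Order forgetfulness provides an isomorphism that also respects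
    \<open>R\<close>.\<close>
  obtain p where p: "isomorphism L p (induced A B) (induced A B')"
    "\<And>a b. a \<in> B \<Longrightarrow> b \<in> B \<Longrightarrow> R (a, b) \<longleftrightarrow> R (p a, p b)"
    using NO_isomorphism[OF R R B(1) B'] by metis
  obtain k where k: "k \<in> G" "\<And>x. x \<in> B \<Longrightarrow> k x = p x"
    using G_extend[OF B(1) B'(1) p(1)] by metis
  have kB: "k ` B = B'"
    using p(1) k(2) by (simp add: isomorphism_def)
  have kR: "R (a, b) \<longleftrightarrow> R (k a, k b)" if "a \<in> B" "b \<in> B" for a b
    using that p(2) k(2) by simp
  let ?k = "restrict (inv_into U k) U"
  have "\<psi> ?k y \<in> solutions x" if "x \<in> J" for x
  proof -
    obtain S P Q g h where x: "x = (S, P, Q, g, h)"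
      by (cases x)
    have xJ: "(S, P, Q, g, h) \<in> J"
      using \<open>x \<in> J\<close> x by simp
    note J'' = J'[OF xJ]
    have "?f (S, P, Q, g, h) \<in> ?f ` J"
      by (rule imageI[OF xJ])
    from bspec[OF mono this] obtain i where
      i: "\<forall>T\<subseteq>B'. isomorphic L (induced A S) (induced A T) \<longrightarrow> colour y S P (act g R) T = i"
      unfolding prod.case by (elim exE)
    have "inv_into U g ` S \<union> inv_into U h ` S \<subseteq> X"
      unfolding X_def using xJ by blast
    from order_trans[OF this B(2)]
    have sub: "inv_into U g ` S \<subseteq> B" "inv_into U h ` S \<subseteq> B"
      by simp_all
    have "\<not> (\<psi> (compose U g ?k) y \<in> P \<and> \<psi> (compose U h ?k) y \<in> Q)"
    proof (rule colour_mono[OF y J''(1) B(1) _ k(1) kR J''(3,4) sub])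
      show "colour y S P (act g R) T = i" if "T \<subseteq> k ` B" "isomorphic L (induced A S) (induced A T)" for T
        using i that kB by simp
      show "act g R (a, b) = act h R (a, b)" if "a \<in> S" "b \<in> S" for a b
        using J''(5) that by simp
    qed
    then show ?thesis
      using J''(3,4) G_inv[OF k(1)] y by (simp add: x solutions_def \<psi>_compose)
  qed
  moreover have "\<psi> ?k y \<in> topspace Y"
    using G_inv[OF k(1)] y by simp
  ultimately show ?thesis
    by (intro bexI[of _ "\<psi> ?k y"] ballI)
qed

lemma all_constraints: "\<exists>y\<in>topspace Y. \<forall>x\<in>constraints. y \<in> solutions x"
proof -
  \<comment> \<open>Adding the whole space keeps the point found in \<open>topspace Y\<close> even
    if there are no constraints.\<close>
  let ?\<U> = "insert (topspace Y) (solutions ` constraints)"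
  have "\<Inter>?\<U> \<noteq> {}"
  proof (rule compact_Y[unfolded compact_space_fip, rule_format], intro conjI ballI allI impI)
    show "closedin Y C" if "C \<in> ?\<U>" for C
      using that solutions_closed by auto
    fix \<F> assume \<F>: "finite \<F> \<and> \<F> \<subseteq> ?\<U>"
    then have "finite (\<F> - {topspace Y})" "\<F> - {topspace Y} \<subseteq> solutions ` constraints"
      by auto
    from finite_subset_image[OF this] obtain J
      where J: "J \<subseteq> constraints" "finite J" "\<F> - {topspace Y} = solutions ` J"
      by (elim exE conjE)
    obtain y where y: "y \<in> topspace Y" "\<forall>x\<in>J. y \<in> solutions x"
      using finitely_many_constraints[OF J(2,1)] by (elim bexE)
    have "y \<in> C" if "C \<in> \<F>" for C
    proof (cases "C = topspace Y")
      case False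
      then have "C \<in> solutions ` J"
        using that J(3) by blast
      then show ?thesis
        using y(2) by blast
    qed (use y(1) in simp)
    then show "\<Inter>\<F> \<noteq> {}"
      by blast
  qed
  then obtain y where "y \<in> \<Inter>?\<U>"
    by blast
  then show ?thesis
    by (intro bexI[of _ y]) simp_all
qed

definition y\<^sub>0 :: 'y where
  "y\<^sub>0 = (SOME y. y \<in> topspace Y \<and> (\<forall>x\<in>constraints. y \<in> solutions x))"

lemma y\<^sub>0: "y\<^sub>0 \<in> topspace Y" "x \<in> constraints \<Longrightarrow> y\<^sub>0 \<in> solutions x"
proof -
  have "\<exists>y. y \<in> topspace Y \<and> (\<forall>x\<in>constraints. y \<in> solutions x)"
    using all_constraints by (elim bexE) (intro exI conjI)
  from someI_ex[OF this] show "y\<^sub>0 \<in> topspace Y" "x \<in> constraints \<Longrightarrow> y\<^sub>0 \<in> solutions x"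
    unfolding y\<^sub>0_def by simp_all
qed

section \<open>Limits of orbit points along orderings\<close>

text \<open>The images of \<open>y\<^sub>0\<close> under those \<open>g\<close> for which
  \<open>act g R\<close> lies in the basic neighbourhood of \<open>Q\<close> given by
  \<open>S\<close>. Points common to all the closures are the limits of
  \<open>\<psi> g y\<^sub>0\<close> as \<open>act g R\<close> tends to \<open>Q\<close>.\<close>

definition approx :: "('a \<times> 'a \<Rightarrow> bool) \<Rightarrow> 'a set \<Rightarrow> 'y set" where
  "approx Q S = {\<psi> g y\<^sub>0 | g. g \<in> G \<and> (\<forall>a\<in>S. \<forall>b\<in>S. act g R (a, b) = Q (a, b))}"

abbreviation limits :: "('a \<times> 'a \<Rightarrow> bool) \<Rightarrow> 'a set \<Rightarrow> 'y set" where
  "limits Q S \<equiv> Abstract_Topology.closure_of Y (approx Q S)"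

lemma approx_subset: "approx Q S \<subseteq> topspace Y"
  using y\<^sub>0(1) by (auto simp: approx_def)

lemma approx_mono: "S \<subseteq> T \<Longrightarrow> approx Q T \<subseteq> approx Q S"
  unfolding approx_def by blast

lemma approx_cong: "(\<And>a b. a \<in> S \<Longrightarrow> b \<in> S \<Longrightarrow> Q (a, b) = Q' (a, b)) \<Longrightarrow> approx Q S = approx Q' S"
  by (simp add: approx_def)

lemma approx_nonempty:
  assumes "Q \<in> NO" "S \<in> \<S>"
  shows "approx Q S \<noteq> {}"
proof -
  obtain g where "g \<in> G" "\<And>a b. a \<in> S \<Longrightarrow> b \<in> S \<Longrightarrow> act g R (a, b) = Q (a, b)"
    using orbit_dense[OF R assms] by metis
  then have "\<psi> g y\<^sub>0 \<in> approx Q S"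
    by (auto simp: approx_def)
  then show ?thesis
    by blast
qed

text \<open>Two limits would have neighbourhoods \<open>P\<close> and \<open>Q'\<close> with
  disjoint closures, separated by some \<open>S\<close>. Approximating both limits at level
  \<open>S\<close> produces \<open>g\<close> and \<open>h\<close> violating a constraint that
  \<open>y\<^sub>0\<close> meets.\<close>

lemma limits_unique:
  assumes z: "\<And>S. S \<in> \<S> \<Longrightarrow> z \<in> limits Q S" and z': "\<And>S. S \<in> \<S> \<Longrightarrow> z' \<in> limits Q S"
  shows "z = z'"
proof (rule ccontr)
  assume ne: "z \<noteq> z'"
  obtain S0 where S0: "S0 \<in> \<S>"
    using fg_cover[of "{}"] by auto
  have top: "z \<in> topspace Y"
    by (rule subsetD[OF closure_of_subset_topspace z[OF S0]])
  have top': "z' \<in> topspace Y"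
    by (rule subsetD[OF closure_of_subset_topspace z'[OF S0]])
  have "normal_space Y"
    using compact_Y Hausdorff_Y compact_Hausdorff_or_regular_imp_normal_space by blast
  moreover have "closedin Y {z}" "closedin Y {z'}"
    using Hausdorff_Y top top' by (simp_all only: closedin_Hausdorff_singleton)
  moreover have "disjnt {z} {z'}"
    using ne by simp
  ultimately have "\<exists>P Q'. openin Y P \<and> openin Y Q' \<and> {z} \<subseteq> P \<and> {z'} \<subseteq> Q' \<and>
      disjnt (Abstract_Topology.closure_of Y P) (Abstract_Topology.closure_of Y Q')"
    by (simp only: normal_space_disjoint_closures)
  then obtain P Q' where P: "openin Y P" "z \<in> P" and Q': "openin Y Q'" "z' \<in> Q'"
    and disj: "Abstract_Topology.closure_of Y P \<inter> Abstract_Topology.closure_of Y Q' = {}"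
    unfolding disjnt_def by (elim exE conjE) simp
  obtain S where S: "separates S (Abstract_Topology.closure_of Y P) (Abstract_Topology.closure_of Y Q')"
    by (rule separates_exists[OF closedin_closure_of closedin_closure_of disj])
  \<comment> \<open>Separation was obtained for the closures and passes to the smaller open sets,
    which is the form used in \<open>constraints\<close>.\<close>
  have sep: "separates S P Q'"
    using S closure_of_subset[OF openin_subset[OF P(1)]] closure_of_subset[OF openin_subset[OF Q'(1)]]
    unfolding separates_def by blast
  then have "S \<in> \<S>"
    by (simp add: separates_def)
  have "\<exists>y. y \<in> approx Q S \<and> y \<in> P" "\<exists>y. y \<in> approx Q S \<and> y \<in> Q'"
    using z[OF \<open>S \<in> \<S>\<close>] z'[OF \<open>S \<in> \<S>\<close>] P Q' unfolding in_closure_of by blast+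
  then obtain g h where g: "g \<in> G" "\<forall>a\<in>S. \<forall>b\<in>S. act g R (a, b) = Q (a, b)" "\<psi> g y\<^sub>0 \<in> P"
    and h: "h \<in> G" "\<forall>a\<in>S. \<forall>b\<in>S. act h R (a, b) = Q (a, b)" "\<psi> h y\<^sub>0 \<in> Q'"
    unfolding approx_def by auto
  have "(S, P, Q', g, h) \<in> constraints"
    using sep P(1) Q'(1) g h by (simp add: constraints_def)
  from y\<^sub>0(2)[OF this] show False
    using g(3) h(3) by (simp add: solutions_def)
qed

text \<open>Compactness of \<open>Y\<close> along the directed family of finite substructures. With
  \<open>C\<close> the whole space it gives existence of limits; with \<open>C\<close> the
  complement of an open set it gives continuity.\<close>

lemma limits_fip:
  assumes Q: "Q \<in> NO" and C: "closedin Y C" and ne: "\<And>S. S \<in> \<S> \<Longrightarrow> limits Q S \<inter> C \<noteq> {}"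
  obtains z where "z \<in> C" "\<And>S. S \<in> \<S> \<Longrightarrow> z \<in> limits Q S"
proof -
  let ?\<U> = "(\<lambda>S. limits Q S \<inter> C) ` \<S>"
  have "\<Inter>?\<U> \<noteq> {}"
  proof (rule compact_Y[unfolded compact_space_fip, rule_format], intro conjI ballI allI impI)
    show "closedin Y D" if "D \<in> ?\<U>" for D
      using that C by (auto intro: closedin_Int)
    fix \<F> assume "finite \<F> \<and> \<F> \<subseteq> ?\<U>"
    then obtain J where J: "J \<subseteq> \<S>" "finite J" "\<F> = (\<lambda>S. limits Q S \<inter> C) ` J"
      using finite_subset_image by metis
    obtain S where S: "S \<in> \<S>" "\<And>T. T \<in> J \<Longrightarrow> T \<subseteq> S"
      using fg_directed[OF J(2,1)] by metis
    have "limits Q S \<inter> C \<subseteq> D" if D: "D \<in> \<F>" for D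
    proof -
      obtain T where T: "T \<in> J" "D = limits Q T \<inter> C"
        using D unfolding J(3) by (elim imageE)
      have "limits Q S \<subseteq> limits Q T"
        by (rule closure_of_mono[OF approx_mono[OF S(2)[OF T(1)]]])
      then show ?thesis
        using T(2) by blast
    qed
    then show "\<Inter>\<F> \<noteq> {}"
      using ne[OF S(1)] by blast
  qed
  then obtain z where "z \<in> \<Inter>?\<U>"
    by blast
  then have z: "z \<in> limits Q S \<inter> C" if "S \<in> \<S>" for S
    using that by blast
  obtain S0 where S0: "S0 \<in> \<S>"
    using fg_cover[of "{}"] by auto
  show thesis
    using that[of z] z z[OF S0] by simp
qed

section \<open>The homomorphism onto \<open>Y\<close>\<close>

definition cover :: "('a \<times> 'a \<Rightarrow> bool) \<Rightarrow> 'y" where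
  "cover Q = (THE z. \<forall>S\<in>\<S>. z \<in> limits Q S)"

lemma cover_eq:
  assumes "\<And>S. S \<in> \<S> \<Longrightarrow> z \<in> limits Q S"
  shows "cover Q = z"
  unfolding cover_def
proof (rule the_equality)
  show "\<forall>S\<in>\<S>. z \<in> limits Q S"
    using assms by simp
  fix z' assume z': "\<forall>S\<in>\<S>. z' \<in> limits Q S"
  show "z' = z"
    by (rule limits_unique[OF bspec[OF z'] assms])
qed

lemma cover_limits:
  assumes Q: "Q \<in> NO" and S: "S \<in> \<S>"
  shows "cover Q \<in> limits Q S"
proof -
  have "limits Q T \<inter> topspace Y \<noteq> {}" if "T \<in> \<S>" for T
    using approx_nonempty[OF Q that] closure_of_subset[OF approx_subset, of Q T] approx_subset[of Q T]
    by blast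
  then obtain z where z: "\<And>S. S \<in> \<S> \<Longrightarrow> z \<in> limits Q S"
    using limits_fip[OF Q closedin_topspace] by metis
  then have "cover Q = z"
    by (rule cover_eq)
  then show ?thesis
    using z S by simp
qed

lemma cover_mem: "Q \<in> NO \<Longrightarrow> cover Q \<in> topspace Y"
  using cover_limits fg_cover[of "{}"] closure_of_subset_topspace by (metis empty_subsetI finite.emptyI subsetD)

text \<open>By compactness and uniqueness of limits, some \<open>limits Q S\<close> already lies in
  \<open>V\<close>. This set depends only on \<open>Q\<close> restricted to \<open>S\<close>, hence
  contains \<open>cover Q'\<close> for every \<open>Q'\<close> that agrees with \<open>Q\<close>
  there.\<close>

lemma continuous_cover: "continuous_map TN Y cover"
  unfolding continuous_map_def
proof (intro conjI allI impI)
  show "cover \<in> topspace TN \<rightarrow> topspace Y"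
    using cover_mem by simp
  fix V assume V: "openin Y V"
  show "openin TN {Q \<in> topspace TN. cover Q \<in> V}"
  proof (subst openin_subopen, rule ballI)
    fix Q assume "Q \<in> {Q \<in> topspace TN. cover Q \<in> V}"
    then have Q: "Q \<in> NO" "cover Q \<in> V"
      by simp_all
    have "\<exists>S\<in>\<S>. limits Q S \<inter> (topspace Y - V) = {}"
    proof (rule ccontr)
      assume "\<not> (\<exists>S\<in>\<S>. limits Q S \<inter> (topspace Y - V) = {})"
      then have ne: "limits Q S \<inter> (topspace Y - V) \<noteq> {}" if "S \<in> \<S>" for S
        using that by metis
      have "closedin Y (topspace Y - V)"
        using V by (simp add: openin_closedin_eq)
      then obtain z where "z \<in> topspace Y - V" "\<And>S. S \<in> \<S> \<Longrightarrow> z \<in> limits Q S"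
        using limits_fip[OF Q(1) _ ne] by metis
      then show False
        using cover_eq[of z Q] Q(2) by simp
    qed
    then obtain S where S: "S \<in> \<S>" "limits Q S \<inter> (topspace Y - V) = {}"
      by (elim bexE)
    let ?W = "{Q' \<in> NO. \<forall>p\<in>S \<times> S. Q' p = Q p}"
    have "openin TN ?W"
      using fg_finite[OF S(1)] fg_subset[OF S(1)] Q(1) by (intro openin_TN) auto
    moreover have "Q \<in> ?W"
      using Q(1) by simp
    moreover have "?W \<subseteq> {Q \<in> topspace TN. cover Q \<in> V}"
    proof
      fix Q' assume "Q' \<in> ?W"
      then have Q': "Q' \<in> NO" "\<And>a b. a \<in> S \<Longrightarrow> b \<in> S \<Longrightarrow> Q' (a, b) = Q (a, b)"
        by auto
      have "approx Q' S = approx Q S"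
        by (rule approx_cong) (rule Q'(2))
      then have "cover Q' \<in> limits Q S"
        using cover_limits[OF Q'(1) S(1)] by simp
      then have "cover Q' \<in> V"
        using S(2) cover_mem[OF Q'(1)] by blast
      then show "Q' \<in> {Q \<in> topspace TN. cover Q \<in> V}"
        using Q'(1) by simp
    qed
    ultimately show "\<exists>T. openin TN T \<and> Q \<in> T \<and> T \<subseteq> {Q \<in> topspace TN. cover Q \<in> V}"
      by (intro exI[of _ ?W] conjI)
  qed
qed

lemma cover_equivariant:
  assumes k: "k \<in> G" and Q: "Q \<in> NO"
  shows "cover (act k Q) = \<psi> k (cover Q)"
proof (rule cover_eq)
  fix S assume S: "S \<in> \<S>"
  let ?h = "restrict (inv_into U k) U"
  \<comment> \<open>Agreement with \<open>Q\<close> on the preimage of \<open>S\<close> under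
    \<open>k\<close> turns, after acting by \<open>k\<close>, into agreement with
    \<open>act k Q\<close> on \<open>S\<close>.\<close>
  let ?T = "?h ` S"
  have SU: "x \<in> U" if "x \<in> S" for x
    using that fg_subset[OF S] by blast
  have "?T \<in> \<S>"
    by (rule Aut_image(2)[OF Aut_inv[OF G_Aut[OF k]] S])
  then have "cover Q \<in> limits Q ?T"
    by (rule cover_limits[OF Q])
  then have "\<psi> k (cover Q) \<in> \<psi> k ` limits Q ?T"
    by (rule imageI)
  also have "\<dots> \<subseteq> Abstract_Topology.closure_of Y (\<psi> k ` approx Q ?T)"
    by (rule continuous_map_image_closure_subset[OF continuous_\<psi>[OF k]])
  also have "\<psi> k ` approx Q ?T \<subseteq> approx (act k Q) S"
  proof
    fix z assume "z \<in> \<psi> k ` approx Q ?T"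
    then obtain g where g: "g \<in> G" "\<forall>a\<in>?T. \<forall>b\<in>?T. act g R (a, b) = Q (a, b)" "z = \<psi> k (\<psi> g y\<^sub>0)"
      unfolding approx_def by auto
    have "act (compose U k g) R (a, b) = act k Q (a, b)" if ab: "a \<in> S" "b \<in> S" for a b
    proof -
      have "inv_into U k a \<in> ?T" "inv_into U k b \<in> ?T"
        using ab SU by (auto intro!: rev_image_eqI[of a] rev_image_eqI[of b])
      then have "act g R (inv_into U k a, inv_into U k b) = Q (inv_into U k a, inv_into U k b)"
        using g(2) by simp
      moreover have "act (compose U k g) R = act k (act g R)"
        by (rule act_compose[OF G_Aut[OF k] G_Aut[OF g(1)] R])
      ultimately show ?thesis
        using SU[OF ab(1)] SU[OF ab(2)] act_NO[OF G_Aut[OF g(1)] R] Q by (simp add: act_eq)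
    qed
    moreover have "z = \<psi> (compose U k g) y\<^sub>0"
      using g(3) \<psi>_compose[OF k g(1) y\<^sub>0(1)] by simp
    ultimately show "z \<in> approx (act k Q) S"
      unfolding approx_def using G_compose[OF k g(1)] by blast
  qed
  then have "Abstract_Topology.closure_of Y (\<psi> k ` approx Q ?T) \<subseteq> limits (act k Q) S"
    by (rule closure_of_mono)
  finally show "\<psi> k (cover Q) \<in> limits (act k Q) S" .
qed

text \<open>Surjectivity is forced by minimality of \<open>Y\<close>: the image of the compact space
  is closed, nonempty and invariant.\<close>

lemma flow_homomorphism_cover:
  "flow_homomorphism H TN act Y \<psi> cover" "cover ` topspace TN = topspace Y"
proof -
  show "flow_homomorphism H TN act Y \<psi> cover"
    unfolding flow_homomorphism_def using continuous_cover cover_equivariant by simp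
  have "closedin Y (cover ` NO)"
  proof -
    have "compactin Y (cover ` NO)"
      using image_compactin[OF _ continuous_cover, of NO] compact_space_TN
      by (simp add: compact_space_def)
    then show ?thesis
      using Hausdorff_Y compactin_imp_closedin by blast
  qed
  moreover have "cover ` NO \<noteq> {}"
    using NO_nonempty by simp
  moreover have "\<psi> g ` cover ` NO \<subseteq> cover ` NO" if "g \<in> carrier H" for g
    using that cover_equivariant act_NO G_Aut by (force simp: image_subset_iff)
  ultimately show "cover ` topspace TN = topspace Y"
    using minimal_Y unfolding minimal_flow_def by simp
qed

end

theorem theorem3:
  fixes L :: "('f, 'r) language"
    and A :: "('f, 'r, 'a) struct"
    and K :: "('f, 'r option, nat) struct set"
    and G :: "('a \<Rightarrow> 'a) set"
  assumes "is_structure L A"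
    and "omega_homogeneous L A"
    and "\<forall>S\<in>fg_substructures L A. finite S"
    and "ramsey_property L (age L A :: ('f, 'r, nat) struct set)"
    and "fraisse_order_class L K"
    and "expansion_of_age L A K"
    and "order_forgetful L K"
    and "subgroup G (aut_group L A)"
    and "aut_topology L A closure_of G = carrier (aut_group L A)"
  shows "universal_minimal_flow TYPE('y)
           ((aut_group L A)\<lparr>carrier := G\<rparr>)
           (subtopology (aut_topology L A) G)
           (normal_orderings_topology L A K)
           (normal_orderings_action L A K)"
proof -
  interpret ramsey_automorphism_group L A K G
    by (intro ramsey_automorphism_group.intro dense_automorphism_group.intro order_expansion.intro
        dense_automorphism_group_axioms.intro ramsey_automorphism_group_axioms.intro assms)
  have "\<exists>h. flow_homomorphism H TN act Y \<psi> h \<and> h ` topspace TN = topspace Y"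
    if flow: "minimal_flow H TG Y \<psi>" for Y :: "'y topology" and \<psi>
  proof -
    \<comment> \<open>Any normal ordering can serve as reference, because every orbit in
      \<open>NO\<close> is dense.\<close>
    obtain R where R: "R \<in> NO"
      using NO_nonempty by blast
    interpret ramsey_minimal_flow L A K G Y \<psi> R
      by (rule ramsey_minimal_flow.intro, rule ramsey_automorphism_group_axioms,
          rule ramsey_minimal_flow_axioms.intro, rule flow, rule R)
    show ?thesis
      using flow_homomorphism_cover by blast
  qed
  then show ?thesis
    unfolding universal_minimal_flow_def using minimal_NO by blast
qed

end
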